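(* Let $\{a_n,b_n\}_{n=1}^\infty$ be Jacobi parameters ($a_n>0$, $b_n\in\mathbb{R}$) with $a_n\to 1$ and $b_n\to 0$, and let $p_n(x)$ be the associated orthonormal polynomials. Then the following are equivalent: (A) $\lim_{n\to\infty} z^n p_n\bigl(z+\tfrac1z\bigr)$ exists for all $z\in\mathbb{D}$, is nonzero for $z\in\mathbb{D}\setminus\mathbb{R}$, and the convergence is uniform on compact subsets of $\mathbb{D}$. (B) All three of the following conditions hold: $(\alpha)$ $\sum_{n=1}^\infty \bigl(|a_n-1|^2+|b_n|^2\bigr)<\infty$; $(\beta)$ $\lim_{n\to\infty} a_n a_{n-1}\cdots a_1$ exists (finite) and is nonzero; $(\gamma)$ $\lim_{n\to\infty}\sum_{j=1}^n b_j$ exists (finite).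
   Context: $\mathbb{D}=\{z\in\mathbb{C}: |z|<1\}$. The orthonormal polynomials associated to Jacobi parameters $\{a_n,b_n\}_{n\ge1}$ are defined by $p_{-1}=0$, $p_0=1$, and $x p_n(x)=a_{n+1}p_{n+1}(x)+b_{n+1}p_n(x)+a_n p_{n-1}(x)$ for $n\ge0$ (with, say, $a_0=1$). The function $z\mapsto z^n p_n(z+1/z)$ is a polynomial in $z$, and its value at $z=0$ is the value of this polynomial. *)

theory Defs
  imports "HOL-Analysis.Analysis" "HOL-Computational_Algebra.Polynomial"
begin

text \<open>Jacobi parameters are sequences whose entries of index at least 1 matter; the entries
  \<open>a 0\<close> and \<open>b 0\<close> are never used (\<open>a 0\<close> would multiply the polynomial of index \<open>-1\<close>,
  which is zero).\<close>

fun orthonormal_poly :: "(nat \<Rightarrow> real) \<Rightarrow> (nat \<Rightarrow> real) \<Rightarrow> nat \<Rightarrow> real poly" where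
  "orthonormal_poly a b 0 = 1"
| "orthonormal_poly a b (Suc 0) = smult (1 / a 1) [:- b 1, 1:]"
| "orthonormal_poly a b (Suc (Suc n)) =
     smult (1 / a (n + 2))
       ([:- b (n + 2), 1:] * orthonormal_poly a b (n + 1) - smult (a (n + 1)) (orthonormal_poly a b n))"

lemma orthonormal_poly_recurrence:
  assumes "\<And>n. n \<ge> 1 \<Longrightarrow> a n > 0"
  shows "x * poly (orthonormal_poly a b n) x =
           a (n + 1) * poly (orthonormal_poly a b (n + 1)) x
           + b (n + 1) * poly (orthonormal_poly a b n) x
           + a n * (if n = 0 then 0 else poly (orthonormal_poly a b (n - 1)) x)"
proof (cases n)
  case 0
  then show ?thesis using assms[of 1] by (simp add: field_simps)
next
  case (Suc m)
  then show ?thesis using assms[of "Suc (Suc m)"] by (simp add: algebra_simps)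
qed

lemma degree_orthonormal_poly_le: "degree (orthonormal_poly a b n) \<le> n"
proof (induction n rule: induct_nat_012)
  case (ge2 n)
  have "degree ([:- b (n + 2), 1:] * orthonormal_poly a b (n + 1)) \<le> Suc (Suc n)"
    using degree_mult_le[of "[:- b (n + 2), 1:]" "orthonormal_poly a b (n + 1)"] ge2 by simp
  moreover have "degree (smult (a (n + 1)) (orthonormal_poly a b n)) \<le> Suc (Suc n)"
    using degree_smult_le[of "a (n + 1)" "orthonormal_poly a b n"] ge2 by linarith
  ultimately have "degree ([:- b (n + 2), 1:] * orthonormal_poly a b (n + 1)
      - smult (a (n + 1)) (orthonormal_poly a b n)) \<le> Suc (Suc n)"
    by (rule degree_diff_le)
  then show ?case
    unfolding orthonormal_poly.simps using degree_smult_le le_trans by blast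
qed simp_all

text \<open>The polynomial in \<open>z\<close> given by \<open>z^n p_n(z + 1/z)\<close>, obtained from
  \<open>z^n (z + 1/z)^k = (z^2 + 1)^k z^(n - k)\<close> for \<open>k \<le> n\<close>.\<close>

definition rescaled_poly :: "(nat \<Rightarrow> real) \<Rightarrow> (nat \<Rightarrow> real) \<Rightarrow> nat \<Rightarrow> complex poly" where
  "rescaled_poly a b n =
     (\<Sum>k\<le>n. smult (complex_of_real (coeff (orthonormal_poly a b n) k))
               ([:1, 0, 1:] ^ k * monom 1 (n - k)))"

lemma poly_rescaled_poly:
  assumes "z \<noteq> 0"
  shows "poly (rescaled_poly a b n) z =
           z ^ n * poly (map_poly complex_of_real (orthonormal_poly a b n)) (z + 1 / z)"
proof -
  let ?p = "orthonormal_poly a b n"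
  have eq: "(1 + z * z) ^ k * z ^ (n - k) = z ^ n * (z + 1 / z) ^ k" if "k \<le> n" for k
  proof -
    have "z ^ n * (z + 1 / z) ^ k = z ^ (n - k) * (z * (z + 1 / z)) ^ k"
      using that by (simp add: power_mult_distrib mult.assoc[symmetric] flip: power_add)
    also have "z * (z + 1 / z) = 1 + z * z" using assms by (simp add: field_simps)
    finally show ?thesis by (simp add: mult.commute)
  qed
  have "poly (map_poly complex_of_real ?p) (z + 1 / z)
          = (\<Sum>k\<le>n. complex_of_real (coeff ?p k) * (z + 1 / z) ^ k)"
    unfolding poly_altdef
    by (rule sum.mono_neutral_cong_left)
       (use degree_orthonormal_poly_le[of a b n] in \<open>auto simp: degree_map_poly coeff_map_poly coeff_eq_0\<close>)
  then show ?thesis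
    by (simp add: rescaled_poly_def poly_sum poly_monom sum_distrib_left eq mult.left_commute)
qed

end

theory Submission
  imports Defs "HOL-Complex_Analysis.Complex_Analysis"
begin

text \<open>
Write \<open>v\<^sub>n(z) = a\<^sub>1 \<cdots> a\<^sub>n z\<^sup>n p\<^sub>n(z + 1/z)\<close>. These polynomials satisfy
  \<open>v\<^sub>n\<^sub>+\<^sub>1 = (1 - b\<^sub>n\<^sub>+\<^sub>1 z + z\<^sup>2) v\<^sub>n - a\<^sub>n\<^sup>2 z\<^sup>2 v\<^sub>n\<^sub>-\<^sub>1\<close> and \<open>v\<^sub>n(0) = 1\<close>.

From asymptotics to parameters, only a neighbourhood of \<open>0\<close> matters. Bounded parameters keep the zeros
  of all \<open>v\<^sub>n\<close> away from \<open>0\<close> (\<open>monic_rescaled_nonzero_near_0\<close>), and the limit does not vanish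
  identically, so by Hurwitz's theorem it is nonzero at \<open>0\<close>. Hence \<open>a\<^sub>1 \<cdots> a\<^sub>n\<close> converges to a nonzero
  number, and the Taylor coefficients of \<open>v\<^sub>n\<close> at \<open>0\<close> converge. The coefficient of \<open>z\<close> is
  \<open>- \<Sum>b\<^sub>j\<close>. The coefficient of \<open>z\<^sup>2\<close>, combined with \<open>(\<Sum>b\<^sub>j)\<^sup>2\<close> and \<open>\<Sum>ln a\<^sub>j\<close>, shows that
  \<open>\<Sum>(b\<^sub>j\<^sup>2/2 + a\<^sub>j\<^sup>2 - 1 - 2 ln a\<^sub>j)\<close> converges; all terms are nonnegative and
  \<open>a\<^sup>2 - 1 - 2 ln a \<ge> (a - 1)\<^sup>2\<close>, which yields square summability
  (\<open>parameters_of_convergence_near_0\<close>).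

From parameters to asymptotics, the recurrence is a perturbation of a linear system with the
  eigenvalues \<open>1\<close> and \<open>z\<^sup>2\<close>. The first-order perturbation \<open>w\<^sub>n\<close> of the eigenvalue \<open>1\<close> is only
  conditionally summable; it is absorbed by the factor \<open>exp (- \<Sum>w\<^sub>n)\<close>, which converges
  (\<open>conjugated_step\<close>). The perturbations that are left are summable, or they are merely square summable
  but couple to the coordinate contracted by \<open>z\<^sup>2\<close>; there the energy \<open>x\<^sup>2 + y\<^sup>2\<close> is a Lyapunov
  function up to summable errors (\<open>lyapunov_step\<close>), and all solutions converge, uniformly for
  \<open>|z| \<le> r < 1\<close> (\<open>monic_rescaled_uniform_limit\<close>). The limit is nonzero at \<open>0\<close>. Off the real
  line it has no zeros by Hurwitz's theorem, because orthogonal polynomials have only real zeros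
  (\<open>complex_orthonormal_nonzero\<close>) and \<open>z + 1/z\<close> is not real for nonreal \<open>z\<close> in the disc.
\<close>

section \<open>The rescaled polynomials: recurrence, zeros and Taylor coefficients\<close>

definition complex_orthonormal :: "(nat \<Rightarrow> real) \<Rightarrow> (nat \<Rightarrow> real) \<Rightarrow> nat \<Rightarrow> complex \<Rightarrow> complex" where
  "complex_orthonormal a b n x = poly (map_poly complex_of_real (orthonormal_poly a b n)) x"

lemma map_poly_of_real_mult_linear:
  "map_poly complex_of_real ([:c, 1:] * p) = [:of_real c, 1:] * map_poly complex_of_real p"
  by (rule poly_eqI) (simp add: coeff_map_poly coeff_pCons split: nat.splits)

lemma complex_orthonormal_0 [simp]: "complex_orthonormal a b 0 x = 1"
  by (simp add: complex_orthonormal_def map_poly_1')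

lemma complex_orthonormal_1:
  assumes "a 1 \<noteq> 0"
  shows "a 1 * complex_orthonormal a b (Suc 0) x = x - b 1"
  using assms by (simp add: complex_orthonormal_def map_poly_smult map_poly_pCons right_diff_distrib)

lemma complex_orthonormal_Suc_Suc:
  assumes "a (n + 2) \<noteq> 0"
  shows "a (n + 2) * complex_orthonormal a b (Suc (Suc n)) x =
           (x - b (n + 2)) * complex_orthonormal a b (Suc n) x - a (n + 1) * complex_orthonormal a b n x"
proof -
  have diff: "map_poly complex_of_real (p - q) = map_poly complex_of_real p - map_poly complex_of_real q" for p q
    by (rule poly_eqI) (simp add: coeff_map_poly)
  have "map_poly complex_of_real (orthonormal_poly a b (Suc (Suc n))) =
      smult (of_real (1 / a (n + 2)))
        ([:of_real (- b (n + 2)), 1:] * map_poly of_real (orthonormal_poly a b (n + 1))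
          - smult (of_real (a (n + 1))) (map_poly of_real (orthonormal_poly a b n)))"
    unfolding orthonormal_poly.simps
    by (subst map_poly_smult) (simp_all only: diff map_poly_of_real_mult_linear map_poly_smult of_real_0 of_real_mult)
  then show ?thesis
    using assms by (simp add: complex_orthonormal_def algebra_simps)
qed

text \<open>The zeros of the orthonormal polynomials are real because the Wronskian-type quantity
  \<open>a\<^sub>n\<^sub>+\<^sub>1 Im (p\<^sub>n\<^sub>+\<^sub>1 cnj p\<^sub>n)\<close> equals \<open>Im x\<close> times \<open>\<Sum>j\<le>n. |p\<^sub>j|\<^sup>2\<close> (the
  Christoffel--Darboux identity on the diagonal), and the sum is at least \<open>|p\<^sub>0|\<^sup>2 = 1\<close>. Only
  this lower bound is carried through the induction; both sides are multiplied by \<open>Im x\<close> so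
  that its sign is irrelevant.\<close>

lemma complex_orthonormal_nonzero:
  assumes a: "\<And>n. n \<ge> 1 \<Longrightarrow> a n > 0" and x: "Im x \<noteq> 0"
  shows "complex_orthonormal a b n x \<noteq> 0"
proof -
  let ?p = "\<lambda>n. complex_orthonormal a b n x"
  have Wronskian: "(Im x)\<^sup>2 \<le> Im x * (a (Suc n) * Im (?p (Suc n) * cnj (?p n)))" for n
  proof (induction n)
    case 0
    have "a 1 * Im (?p (Suc 0)) = Im (a 1 * ?p (Suc 0))" by simp
    also have "\<dots> = Im x" using complex_orthonormal_1[of a b x] a[of 1] by simp
    finally show ?case by (simp add: power2_eq_square)
  next
    case (Suc n)
    have "a (n + 2) * Im (?p (Suc (Suc n)) * cnj (?p (Suc n)))
            = Im (a (n + 2) * ?p (Suc (Suc n)) * cnj (?p (Suc n)))"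
      by (simp add: algebra_simps)
    also have "\<dots> = Im (((x - b (n + 2)) * ?p (Suc n) - a (n + 1) * ?p n) * cnj (?p (Suc n)))"
      using complex_orthonormal_Suc_Suc[of a n b x] a[of "n + 2"] by simp
    also have "\<dots> = Im x * (cmod (?p (Suc n)))\<^sup>2 + a (Suc n) * Im (?p (Suc n) * cnj (?p n))"
      by (simp add: cmod_power2) (simp add: algebra_simps power2_eq_square)
    finally have eq: "a (Suc (Suc n)) * Im (?p (Suc (Suc n)) * cnj (?p (Suc n)))
        = Im x * (cmod (?p (Suc n)))\<^sup>2 + a (Suc n) * Im (?p (Suc n) * cnj (?p n))" by simp
    have "Im x * (a (Suc (Suc n)) * Im (?p (Suc (Suc n)) * cnj (?p (Suc n))))
        = (Im x)\<^sup>2 * (cmod (?p (Suc n)))\<^sup>2 + Im x * (a (Suc n) * Im (?p (Suc n) * cnj (?p n)))"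
      unfolding eq by (simp only: distrib_left power2_eq_square[of "Im x"] mult.assoc)
    moreover have "(Im x)\<^sup>2 * (cmod (?p (Suc n)))\<^sup>2 \<ge> 0" by simp
    ultimately show ?case using Suc.IH by linarith
  qed
  show ?thesis
  proof (cases n)
    case (Suc m)
    then show ?thesis using Wronskian[of m] x by auto
  qed simp
qed

lemma Im_joukowski_nonzero:
  assumes "z \<in> ball 0 1 - \<real>"
  shows "Im (z + 1 / z) \<noteq> 0"
proof -
  have z: "Im z \<noteq> 0" "norm z < 1" "z \<noteq> 0" using assms by (auto simp: complex_is_Real_iff)
  then have n: "0 < (cmod z)\<^sup>2" "(cmod z)\<^sup>2 < 1" by (auto simp: power_less_one_iff abs_square_less_1)
  have "Im (z + 1 / z) = Im z * (1 - 1 / (cmod z)\<^sup>2)"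
    by (simp add: Im_divide cmod_power2 algebra_simps)
  then show ?thesis using z n by simp
qed

lemma rescaled_poly_nonreal_nonzero:
  assumes "\<And>n. n \<ge> 1 \<Longrightarrow> a n > 0" and z: "z \<in> ball 0 1 - \<real>"
  shows "poly (rescaled_poly a b n) z \<noteq> 0"
proof -
  have "z \<noteq> 0" using z by auto
  then show ?thesis
    using complex_orthonormal_nonzero[of a "z + 1 / z" b n] Im_joukowski_nonzero[OF z] assms(1)
    by (simp add: poly_rescaled_poly complex_orthonormal_def)
qed

text \<open>Multiplying by \<open>a\<^sub>1 \<cdots> a\<^sub>n\<close> passes to the monic orthogonal polynomials. It clears the division in
  the recurrence and normalises the value at \<open>0\<close> to \<open>1\<close>.\<close>

definition monic_rescaled :: "(nat \<Rightarrow> real) \<Rightarrow> (nat \<Rightarrow> real) \<Rightarrow> nat \<Rightarrow> complex poly" where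
  "monic_rescaled a b n = smult (of_real (\<Prod>j=1..n. a j)) (rescaled_poly a b n)"

text \<open>The formula \<open>z\<^sup>n p\<^sub>n(z + 1/z)\<close> makes sense only for \<open>z \<noteq> 0\<close>; polynomial identities derived from it
  extend to \<open>z = 0\<close> in this way.\<close>

lemma poly_eqI_nonzero:
  fixes p q :: "complex poly"
  assumes "\<And>z. z \<noteq> 0 \<Longrightarrow> poly p z = poly q z"
  shows "p = q"
proof (rule ccontr)
  assume "p \<noteq> q"
  then have "finite {z. poly (p - q) z = 0}" by (intro poly_roots_finite) simp
  moreover have "- {0} \<subseteq> {z. poly (p - q) z = 0}" using assms by auto
  ultimately have "finite (- {0 :: complex})" by (rule rev_finite_subset)
  then show False by (simp add: infinite_UNIV_char_0)
qed

lemma monic_rescaled_0 [simp]: "monic_rescaled a b 0 = 1"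
  by (simp add: monic_rescaled_def rescaled_poly_def)

lemma monic_rescaled_1:
  assumes "a 1 \<noteq> 0"
  shows "monic_rescaled a b (Suc 0) = [:1, - of_real (b 1), 1:]"
proof (rule poly_eqI_nonzero)
  fix z :: complex assume z: "z \<noteq> 0"
  have "poly (monic_rescaled a b (Suc 0)) z = z * (a 1 * complex_orthonormal a b (Suc 0) (z + 1 / z))"
    using z by (simp add: monic_rescaled_def poly_rescaled_poly complex_orthonormal_def)
  also have "\<dots> = z * (z + 1 / z - b 1)" using complex_orthonormal_1[of a b, OF assms] by simp
  also have "\<dots> = poly [:1, - of_real (b 1), 1:] z" using z by (simp add: algebra_simps)
  finally show "poly (monic_rescaled a b (Suc 0)) z = poly [:1, - of_real (b 1), 1:] z" .
qed

lemma monic_rescaled_Suc_Suc: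
  assumes "a (n + 2) \<noteq> 0"
  shows "monic_rescaled a b (Suc (Suc n)) =
           [:1, - of_real (b (n + 2)), 1:] * monic_rescaled a b (Suc n)
             - [:0, 0, of_real ((a (n + 1))\<^sup>2):] * monic_rescaled a b n"
proof (rule poly_eqI_nonzero)
  fix z :: complex assume z: "z \<noteq> 0"
  let ?p = "\<lambda>n. complex_orthonormal a b n (z + 1 / z)" and ?P = "\<lambda>n. complex_of_real (\<Prod>j=1..n. a j)"
  have val: "poly (monic_rescaled a b n) z = ?P n * (z ^ n * ?p n)" for n
    using z by (simp add: monic_rescaled_def poly_rescaled_poly complex_orthonormal_def)
  have P: "?P (Suc n) = a (n + 1) * ?P n" "?P (Suc (Suc n)) = a (n + 2) * ?P (Suc n)"
    by (simp_all add: prod.nat_ivl_Suc' mult.assoc)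
  have "poly (monic_rescaled a b (Suc (Suc n))) z
      = ?P (Suc n) * z ^ Suc (Suc n) * (a (n + 2) * ?p (Suc (Suc n)))"
    unfolding val P(2) by (simp add: mult_ac)
  also have "\<dots> = ?P (Suc n) * z ^ Suc (Suc n) * ((z + 1 / z - b (n + 2)) * ?p (Suc n) - a (n + 1) * ?p n)"
    using complex_orthonormal_Suc_Suc[of a n b, OF assms] by simp
  also have "\<dots> = (z * (z + 1 / z - b (n + 2))) * (?P (Suc n) * (z ^ Suc n * ?p (Suc n)))
      - z\<^sup>2 * (a (n + 1))\<^sup>2 * (?P n * (z ^ n * ?p n))"
    unfolding P(1) by (simp add: algebra_simps power2_eq_square)
  also have "z * (z + 1 / z - b (n + 2)) = 1 - b (n + 2) * z + z\<^sup>2"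
    using z by (simp add: algebra_simps power2_eq_square)
  finally show "poly (monic_rescaled a b (Suc (Suc n))) z = poly
      ([:1, - of_real (b (n + 2)), 1:] * monic_rescaled a b (Suc n)
             - [:0, 0, of_real ((a (n + 1))\<^sup>2):] * monic_rescaled a b n) z"
    unfolding val[symmetric] by (simp add: algebra_simps power2_eq_square)
qed

lemma poly_monic_rescaled_Suc_Suc:
  assumes "a (n + 2) \<noteq> 0"
  shows "poly (monic_rescaled a b (Suc (Suc n))) z =
           (1 - of_real (b (n + 2)) * z + z\<^sup>2) * poly (monic_rescaled a b (Suc n)) z
             - (of_real (a (n + 1)))\<^sup>2 * z\<^sup>2 * poly (monic_rescaled a b n) z"
  unfolding monic_rescaled_Suc_Suc[of a n b, OF assms] poly_diff poly_mult
  by (simp add: algebra_simps power2_eq_square)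

text \<open>The link between asymptotics and parameters: the first three Taylor coefficients at \<open>0\<close> are explicit.
  In the coefficient of \<open>z\<^sup>2\<close> the double sum \<open>\<Sum>i<j. b\<^sub>i b\<^sub>j\<close> appears in the form
  \<open>((\<Sum>b)\<^sup>2 - \<Sum>b\<^sup>2)/2\<close>, which exposes the sum of squares. The parameter \<open>a\<^sub>n\<^sub>+\<^sub>1\<close> does not
  enter there at index \<open>n + 1\<close>, whence the different summation ranges for \<open>a\<close> and \<open>b\<close>.\<close>

lemma coeff_monic_rescaled:
  assumes a: "\<And>n. n \<ge> 1 \<Longrightarrow> a n > 0"
  shows "coeff (monic_rescaled a b n) 0 = 1"
    and "coeff (monic_rescaled a b n) 1 = - of_real (\<Sum>j=1..n. b j)"
    and "coeff (monic_rescaled a b (Suc n)) 2 =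
           of_real (((\<Sum>j=1..Suc n. b j)\<^sup>2 - (\<Sum>j=1..Suc n. (b j)\<^sup>2)) / 2 - (\<Sum>j=1..n. (a j)\<^sup>2 - 1) + 1)"
proof -
  have a': "a (n + 2) \<noteq> 0" for n using a[of "n + 2"] by simp
  have coeffs: "coeff ([:1, c, 1:] * p - [:0, 0, d:] * q) 0 = coeff p 0"
    "coeff ([:1, c, 1:] * p - [:0, 0, d:] * q) 1 = coeff p 1 + c * coeff p 0"
    "coeff ([:1, c, 1:] * p - [:0, 0, d:] * q) 2 = coeff p 2 + c * coeff p 1 + coeff p 0 - d * coeff q 0"
    for c d :: complex and p q
    by (simp_all add: numeral_2_eq_2 One_nat_def)
  show 0: "coeff (monic_rescaled a b n) 0 = 1" for n
  proof (induction n rule: induct_nat_012)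
    case (ge2 n)
    show ?case unfolding monic_rescaled_Suc_Suc[of a n b, OF a'] coeffs ge2 ..
  qed (use monic_rescaled_1[of a b] a[of 1] in \<open>simp_all\<close>)
  show 1: "coeff (monic_rescaled a b n) 1 = - of_real (\<Sum>j=1..n. b j)" for n
  proof (induction n rule: induct_nat_012)
    case (ge2 n)
    show ?case unfolding monic_rescaled_Suc_Suc[of a n b, OF a'] coeffs 0 ge2
      by (simp add: sum.nat_ivl_Suc')
  qed (use monic_rescaled_1[of a b] a[of 1] in \<open>simp_all add: coeff_pCons\<close>)
  show "coeff (monic_rescaled a b (Suc n)) 2 =
       of_real (((\<Sum>j=1..Suc n. b j)\<^sup>2 - (\<Sum>j=1..Suc n. (b j)\<^sup>2)) / 2 - (\<Sum>j=1..n. (a j)\<^sup>2 - 1) + 1)"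
  proof (induction n)
    case 0
    show ?case using monic_rescaled_1[of a b] a[of 1] by (simp add: numeral_2_eq_2 power2_eq_square)
  next
    case (Suc n)
    have B: "(\<Sum>j=1..Suc (Suc n). f j) = (\<Sum>j=1..Suc n. f j) + f (n + 2)" for f :: "nat \<Rightarrow> real"
      by simp
    have A: "(\<Sum>j=1..Suc n. (a j)\<^sup>2 - 1) = (\<Sum>j=1..n. (a j)\<^sup>2 - 1) + (a (n + 1))\<^sup>2 - 1" by simp
    show ?case unfolding monic_rescaled_Suc_Suc[of a n b, OF a'] coeffs 0 1 Suc.IH A B
      by (simp add: power2_eq_square field_simps)
  qed
qed

section \<open>Zeros of locally uniform limits\<close>

text \<open>Hurwitz's theorem in a form that applies when the limit is known to be nonzero at some point \<open>w\<close>
  of the larger domain: a limit that is constant on \<open>S\<close> is constant on \<open>U\<close> by analytic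
  continuation, and the constant is \<open>g w \<noteq> 0\<close>.\<close>

lemma nonvanishing_locally_uniform_limit:
  fixes f :: "nat \<Rightarrow> complex \<Rightarrow> complex"
  assumes U: "open U" "connected U" and holf: "\<And>n. f n holomorphic_on U"
    and lim: "\<And>K. compact K \<Longrightarrow> K \<subseteq> U \<Longrightarrow> uniform_limit K f g sequentially"
    and w: "w \<in> U" "g w \<noteq> 0"
    and S: "open S" "connected S" "S \<subseteq> U" "\<And>n z. z \<in> S \<Longrightarrow> f n z \<noteq> 0" and z: "z \<in> S"
  shows "g z \<noteq> 0"
proof -
  have holg: "g holomorphic_on U"
  proof (rule holomorphic_uniform_sequence[OF U(1) holf])
    fix x assume "x \<in> U"
    with U(1) obtain d where d: "0 < d" "cball x d \<subseteq> U" by (metis open_contains_cball)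
    show "\<exists>d>0. cball x d \<subseteq> U \<and> uniform_limit (cball x d) f g sequentially"
      by (intro exI[of _ d] conjI d lim compact_cball)
  qed
  show ?thesis
  proof (cases "g constant_on S")
    case False
    show ?thesis
    proof (rule Hurwitz_no_zeros[OF S(1,2) _ _ _ False S(4) z])
      show "f n holomorphic_on S" for n by (rule holomorphic_on_subset[OF holf S(3)])
      show "g holomorphic_on S" by (rule holomorphic_on_subset[OF holg S(3)])
      show "uniform_limit K f g sequentially" if "compact K" "K \<subseteq> S" for K
        by (rule lim[OF that(1) order_trans[OF that(2) S(3)]])
    qed
  next
    case True
    then have "g x = g z" if "x \<in> S" for x using that z unfolding constant_on_def by metis
    moreover have "S \<noteq> {}" using z by blast
    ultimately have "g w = g z"
      using analytic_continuation_open[OF S(1) U(1) _ U(2) S(3) holg holomorphic_on_const _ w(1)] by metis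
    with w show ?thesis by simp
  qed
qed

section \<open>From convergence near the origin to the parameters\<close>

lemma coeff_convergent_of_uniform_limit:
  fixes p :: "nat \<Rightarrow> complex poly"
  assumes lim: "uniform_limit U (\<lambda>n. poly (p n)) L sequentially" and U: "open U" "0 \<in> U"
  shows "convergent (\<lambda>n. coeff (p n) k)"
proof -
  have deriv_poly: "(deriv ^^ k) (poly q) = poly ((pderiv ^^ k) q)" for k and q :: "complex poly"
  proof (induction k)
    case (Suc k)
    have "deriv (poly p) = poly (pderiv p)" for p :: "complex poly"
      by (rule ext) (rule DERIV_imp_deriv[OF poly_DERIV])
    with Suc show ?case by simp
  qed simp
  have "(deriv ^^ k) (poly q) 0 = fact k * coeff q k" for q :: "complex poly"
    by (simp add: deriv_poly poly_0_coeff_0 coeff_higher_pderiv pochhammer_fact)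
  moreover have "(\<lambda>n. (deriv ^^ k) (poly (p n)) 0) \<longlonglongrightarrow> (deriv ^^ k) L 0"
    by (rule higher_deriv_complex_uniform_limit[OF lim])
       (use U in \<open>auto intro!: always_eventually holomorphic_intros\<close>)
  ultimately have "(\<lambda>n. fact k * coeff (p n) k / fact k) \<longlonglongrightarrow> (deriv ^^ k) L 0 / fact k"
    by (intro tendsto_divide) auto
  then show ?thesis by (auto simp: convergent_def)
qed

text \<open>For bounded parameters the eigenvalues of all truncated Jacobi matrices lie in a fixed interval, so
  \<open>z + 1/z\<close> avoids them when \<open>|z|\<close> is small. Quantitatively: near \<open>0\<close> the recurrence is a small
  perturbation of \<open>v\<^sub>n\<^sub>+\<^sub>1 = v\<^sub>n\<close>, so that each value is at least half the previous one.\<close>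

lemma monic_rescaled_nonzero_near_0:
  assumes a: "\<And>n. n \<ge> 1 \<Longrightarrow> a n > 0"
    and A: "\<And>n. \<bar>a n\<bar> \<le> A" and B: "\<And>n. \<bar>b n\<bar> \<le> B"
    and z: "norm z \<le> 1 / (2 * (1 + B + 2 * A\<^sup>2))"
  shows "poly (monic_rescaled a b n) z \<noteq> 0"
proof -
  let ?v = "\<lambda>n. poly (monic_rescaled a b n) z"
  have B0: "0 \<le> B" using B[of 0] by linarith
  define N where "N = 1 + B + 2 * A\<^sup>2"
  have N1: "1 \<le> N" using B0 by (simp add: N_def)
  have nz: "norm z * N \<le> 1 / 2" using z N1 unfolding N_def[symmetric] by (simp add: field_simps)
  have z1: "norm z \<le> 1" using nz N1 mult_left_mono[OF N1, of "norm z"] by simp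
  have z2: "norm (z\<^sup>2) \<le> norm z" using mult_left_mono[OF z1, of "norm z"] by (simp add: norm_mult power2_eq_square)
  have small: "norm (z\<^sup>2) + norm (b m * z) + 2 * norm (complex_of_real ((a k)\<^sup>2) * z\<^sup>2) \<le> 1 / 2" for m k
  proof -
    have "norm (b m * z) \<le> B * norm z" unfolding norm_mult using B by (intro mult_right_mono) auto
    moreover have "norm (complex_of_real ((a k)\<^sup>2) * z\<^sup>2) \<le> A\<^sup>2 * norm z"
    proof -
      have "(a k)\<^sup>2 \<le> A\<^sup>2" using power_mono[OF A, of k 2] by simp
      then have "norm (complex_of_real ((a k)\<^sup>2)) \<le> A\<^sup>2" by (simp only: norm_of_real abs_power2)
      then show ?thesis unfolding norm_mult using z2 by (intro mult_mono) auto
    qed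
    ultimately have "norm (z\<^sup>2) + norm (b m * z) + 2 * norm (complex_of_real ((a k)\<^sup>2) * z\<^sup>2) \<le> norm z * N"
      using z2 by (simp add: N_def algebra_simps)
    with nz show ?thesis by linarith
  qed
  have "?v n \<noteq> 0 \<and> norm (?v n) \<le> 2 * norm (?v (Suc n))" for n
  proof (induction n)
    case 0
    have "?v (Suc 0) = 1 - (b 1 * z - z\<^sup>2)"
      using monic_rescaled_1[of a b] a[of 1] by (simp add: algebra_simps power2_eq_square)
    moreover have "norm (b 1 * z - z\<^sup>2) \<le> norm (b 1 * z) + norm (z\<^sup>2)" by (rule norm_triangle_ineq4)
    moreover have "norm (b 1 * z) + norm (z\<^sup>2) \<le> 1 / 2"
      using small[of 1 0] norm_ge_zero[of "complex_of_real ((a 0)\<^sup>2) * z\<^sup>2"] by linarith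
    ultimately show ?case using norm_triangle_ineq2[of 1 "b 1 * z - z\<^sup>2"] by simp
  next
    case (Suc n)
    let ?q = "b (n + 2) * z - z\<^sup>2" and ?s = "complex_of_real ((a (n + 1))\<^sup>2) * z\<^sup>2"
    have eq: "?v (Suc (Suc n)) = ?v (Suc n) - (?q * ?v (Suc n) + ?s * ?v n)"
      using poly_monic_rescaled_Suc_Suc[of a n b z] a[of "n + 2"] by (simp add: algebra_simps power2_eq_square)
    have "norm (?q * ?v (Suc n) + ?s * ?v n) \<le> norm ?q * norm (?v (Suc n)) + norm ?s * norm (?v n)"
      by (metis norm_triangle_ineq norm_mult)
    also have "\<dots> \<le> norm ?q * norm (?v (Suc n)) + norm ?s * (2 * norm (?v (Suc n)))"
      using Suc by (intro add_mono mult_left_mono) auto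
    also have "\<dots> = (norm ?q + 2 * norm ?s) * norm (?v (Suc n))" by (simp add: algebra_simps)
    also have "\<dots> \<le> 1 / 2 * norm (?v (Suc n))"
    proof (rule mult_right_mono)
      show "norm ?q + 2 * norm ?s \<le> 1 / 2"
        using small[of "n + 2" "n + 1"] norm_triangle_ineq4[of "b (n + 2) * z" "z\<^sup>2"] by linarith
    qed simp
    finally have "norm (?v (Suc n)) \<le> 2 * norm (?v (Suc (Suc n)))"
      unfolding eq using norm_triangle_ineq2[of "?v (Suc n)" "?q * ?v (Suc n) + ?s * ?v n"] by simp
    then show ?case using Suc by auto
  qed
  then show ?thesis by blast
qed

text \<open>The nonnegative function \<open>t\<^sup>2 - 1 - 2 ln t\<close>, the entropy term of the Killip--Simon sum rule, has a
  double zero at \<open>t = 1\<close>. Comparing it with \<open>(t - 1)\<^sup>2\<close> in both directions converts between square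
  summability of \<open>a\<^sub>n - 1\<close> and convergence of \<open>\<Sum>(a\<^sub>n\<^sup>2 - 1)\<close>, given that \<open>\<Sum>ln a\<^sub>n\<close> converges.\<close>

lemma square_minus_1_minus_2_ln_ge:
  fixes t :: real assumes "t > 0"
  shows "(t - 1)\<^sup>2 \<le> t\<^sup>2 - 1 - 2 * ln t"
  using ln_le_minus_one[OF assms] by (simp add: power2_eq_square algebra_simps)

lemma square_minus_1_minus_2_ln_le:
  fixes t :: real assumes "t \<ge> 2 / 3"
  shows "t\<^sup>2 - 1 - 2 * ln t \<le> 4 * (t - 1)\<^sup>2"
proof -
  have t: "t > 0" using assms by linarith
  have "- ln t \<le> 1 / t - 1" using ln_le_minus_one[of "1 / t"] t by (simp add: ln_div)
  then have "2 * (- ln t) \<le> 2 * (1 / t - 1)" by (rule mult_left_mono) simp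
  then have "t\<^sup>2 - 1 - 2 * ln t \<le> t\<^sup>2 - 1 + 2 * (1 / t - 1)" by simp
  also have "\<dots> = (t - 1)\<^sup>2 * ((t + 2) / t)" using t by (simp add: field_simps power2_eq_square)
  also have "\<dots> \<le> (t - 1)\<^sup>2 * 4" using t assms by (intro mult_left_mono) (auto simp: field_simps)
  finally show ?thesis by simp
qed

lemma ln_prod_parameters:
  fixes a :: "nat \<Rightarrow> real"
  assumes "\<And>n. n \<ge> 1 \<Longrightarrow> a n > 0"
  shows "(\<Sum>j=1..n. ln (a j)) = ln (\<Prod>j=1..n. a j)"
proof -
  have "a i \<noteq> 0" if "i \<ge> 1" for i using assms[OF that] by simp
  then show ?thesis by (subst ln_prod) auto
qed

lemma prod_times_rescaled_poly_0:
  assumes "\<And>n. n \<ge> 1 \<Longrightarrow> a n > 0"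
  shows "of_real (\<Prod>j=1..n. a j) * poly (rescaled_poly a b n) 0 = 1"
  using coeff_monic_rescaled(1)[of a b n] assms by (simp add: monic_rescaled_def poly_0_coeff_0)

text \<open>The coefficients of \<open>1\<close>, \<open>z\<close> and \<open>z\<^sup>2\<close> converge. The first gives the product of the \<open>a\<^sub>j\<close>, the
  second the sum of the \<open>b\<^sub>j\<close>, and the third then the sum \<open>\<Sum>b\<^sup>2 + 2 \<Sum>(a\<^sup>2 - 1)\<close>. Subtracting
  the convergent \<open>4 \<Sum>ln a\<close> leaves a convergent series of nonnegative terms, which dominates
  \<open>\<Sum>((a - 1)\<^sup>2 + b\<^sup>2)\<close>. It is essential that \<open>a\<close> and \<open>b\<close> contribute to the coefficient of
  \<open>z\<^sup>2\<close> with the same sign.\<close>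

lemma parameters_of_convergence_near_0:
  fixes a b :: "nat \<Rightarrow> real"
  assumes a: "\<And>n. n \<ge> 1 \<Longrightarrow> a n > 0"
    and lim: "uniform_limit U (\<lambda>n. poly (rescaled_poly a b n)) L sequentially"
    and U: "open U" "0 \<in> U" and L0: "L 0 \<noteq> 0"
  shows "summable (\<lambda>n. \<bar>a (Suc n) - 1\<bar>\<^sup>2 + \<bar>b (Suc n)\<bar>\<^sup>2)"
    and "\<exists>l. l \<noteq> 0 \<and> (\<lambda>n. \<Prod>j=1..n. a j) \<longlonglongrightarrow> l"
    and "convergent (\<lambda>n. \<Sum>j=1..n. b j)"
proof -
  define P where "P n = (\<Prod>j=1..n. a j)" for n
  have Ppos: "P n > 0" for n unfolding P_def using a by (intro prod_pos) auto
  have P_eq: "P n = 1 / norm (poly (rescaled_poly a b n) 0)" for n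
  proof -
    have "norm (of_real (P n) * poly (rescaled_poly a b n) 0) = 1"
      using prod_times_rescaled_poly_0[of a n b] a by (simp add: P_def)
    then show ?thesis using Ppos[of n] by (auto simp: norm_mult eq_divide_eq)
  qed
  have P_lim: "P \<longlonglongrightarrow> 1 / norm (L 0)"
    unfolding P_eq[abs_def] using L0 by (intro tendsto_intros tendsto_uniform_limitI[OF lim U(2)]) auto
  then show "\<exists>l. l \<noteq> 0 \<and> (\<lambda>n. \<Prod>j=1..n. a j) \<longlonglongrightarrow> l"
    using L0 unfolding P_def[symmetric] by (intro exI[of _ "1 / norm (L 0)"]) auto
  have "convergent (\<lambda>n. complex_of_real (P n))"
    using tendsto_of_real[OF P_lim] by (auto simp: convergent_def)
  then have coeff_conv: "convergent (\<lambda>n. coeff (monic_rescaled a b n) k)" for k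
    using coeff_convergent_of_uniform_limit[OF lim U, of k]
    unfolding monic_rescaled_def coeff_smult P_def by (rule convergent_mult)
  have Re_conv: "convergent (\<lambda>n. Re (f n))" if "convergent f" for f
    using that tendsto_Re unfolding convergent_def by blast
  have "convergent (\<lambda>n. - (\<Sum>j=1..n. b j))"
    using Re_conv[OF coeff_conv[of 1]] by (simp only: coeff_monic_rescaled[of a b, OF a] Re_complex_of_real flip: of_real_minus)
  then show bconv: "convergent (\<lambda>n. \<Sum>j=1..n. b j)" by (simp add: convergent_minus_iff[symmetric])
  define Q where "Q n = ((\<Sum>j=1..Suc n. b j)\<^sup>2 - (\<Sum>j=1..Suc n. (b j)\<^sup>2)) / 2 - (\<Sum>j=1..n. (a j)\<^sup>2 - 1) + 1" for n
  have "convergent (\<lambda>n. coeff (monic_rescaled a b (Suc n)) 2)"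
    using coeff_conv[of 2] convergent_Suc_iff[of "\<lambda>n. coeff (monic_rescaled a b n) 2"] by blast
  from Re_conv[OF this] have Q_conv: "convergent Q"
    by (simp only: coeff_monic_rescaled[of a b, OF a] Re_complex_of_real Q_def[symmetric])
  have bconv': "convergent (\<lambda>n. \<Sum>j=1..Suc n. b j)"
    using bconv convergent_Suc_iff[of "\<lambda>n. \<Sum>j=1..n. b j"] by blast
  obtain lb lq where lb: "(\<lambda>n. \<Sum>j=1..Suc n. b j) \<longlonglongrightarrow> lb" and lq: "Q \<longlonglongrightarrow> lq"
    using bconv' Q_conv unfolding convergent_def by blast
  \<comment> \<open>\<open>Q n\<close> is the coefficient of \<open>z\<^sup>2\<close>; \<open>F n\<close> solves it for the combination of sums with
    nonnegative terms, as \<open>F_eq\<close> shows.\<close>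
  define F where "F n = (\<Sum>j=1..Suc n. b j)\<^sup>2 - 2 * Q n + 2 - 4 * ln (P n)" for n
  have "F \<longlonglongrightarrow> lb\<^sup>2 - 2 * lq + 2 - 4 * ln (1 / norm (L 0))"
    unfolding F_def using L0 by (intro tendsto_intros lb lq P_lim) auto
  then obtain M where M: "\<And>n. \<bar>F n\<bar> \<le> M"
    using convergent_imp_Bseq[of F] unfolding convergent_def Bseq_def by (metis real_norm_def)
  have F_eq: "F n = (\<Sum>j=1..Suc n. (b j)\<^sup>2) + 2 * (\<Sum>j=1..n. (a j)\<^sup>2 - 1 - 2 * ln (a j))" for n
  proof -
    have eq: "(\<Sum>j=1..n. (a j)\<^sup>2 - 1 - 2 * ln (a j)) = (\<Sum>j=1..n. (a j)\<^sup>2 - 1) - 2 * ln (P n)"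
      using ln_prod_parameters[of a n] a by (simp add: P_def sum_subtractf sum_distrib_left[symmetric])
    have alg: "x\<^sup>2 - 2 * ((x\<^sup>2 - y) / 2 - s + 1) + 2 - 4 * l = y + 2 * (s - 2 * l)" for x y s l :: real
      by (simp add: field_simps)
    show ?thesis unfolding F_def Q_def eq by (rule alg)
  qed
  have "(\<Sum>k<n. \<bar>a (Suc k) - 1\<bar>\<^sup>2 + \<bar>b (Suc k)\<bar>\<^sup>2) \<le> M" for n
  proof -
    have "(\<Sum>k<n. \<bar>a (Suc k) - 1\<bar>\<^sup>2 + \<bar>b (Suc k)\<bar>\<^sup>2) = (\<Sum>j=1..n. (a j - 1)\<^sup>2) + (\<Sum>j=1..n. (b j)\<^sup>2)"
      by (simp add: sum.distrib sum.atLeast1_atMost_eq)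
    also have "(\<Sum>j=1..n. (a j - 1)\<^sup>2) \<le> (\<Sum>j=1..n. (a j)\<^sup>2 - 1 - 2 * ln (a j))"
      using a by (intro sum_mono square_minus_1_minus_2_ln_ge) auto
    also have "\<dots> \<le> 2 * (\<Sum>j=1..n. (a j)\<^sup>2 - 1 - 2 * ln (a j))"
    proof -
      have "0 \<le> (\<Sum>j=1..n. (a j)\<^sup>2 - 1 - 2 * ln (a j))"
        using a by (intro sum_nonneg) (meson atLeastAtMost_iff order_trans square_minus_1_minus_2_ln_ge zero_le_power2)
      then show ?thesis by simp
    qed
    also have "(\<Sum>j=1..n. (b j)\<^sup>2) \<le> (\<Sum>j=1..Suc n. (b j)\<^sup>2)" by simp
    finally show ?thesis using M[of n] unfolding F_eq by linarith
  qed
  then show "summable (\<lambda>n. \<bar>a (Suc n) - 1\<bar>\<^sup>2 + \<bar>b (Suc n)\<bar>\<^sup>2)"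
    by (intro bounded_imp_summable[where B = M]) (auto simp: lessThan_Suc_atMost[symmetric] simp del: sum.lessThan_Suc)
qed

section \<open>Square summable perturbations of a partially contracting system\<close>

lemma square_convex_combination_le:
  fixes \<rho> y q :: real
  assumes "0 \<le> \<rho>" "\<rho> < 1"
  shows "(\<rho> * y + q)\<^sup>2 \<le> \<rho> * y\<^sup>2 + q\<^sup>2 / (1 - \<rho>)"
proof -
  have "\<rho> * y\<^sup>2 + q\<^sup>2 / (1 - \<rho>) - (\<rho> * y + q)\<^sup>2 = \<rho> / (1 - \<rho>) * ((1 - \<rho>) * y - q)\<^sup>2"
    using assms by (simp add: field_simps power2_eq_square)
  also have "\<dots> \<ge> 0" using assms by simp
  finally show ?thesis by simp
qed

text \<open>Off-diagonal entries of first order in \<open>h\<close> change the energy \<open>x\<^sup>2 + y\<^sup>2\<close> only to second order: the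
  cross terms \<open>h x y\<close> split into \<open>O(h\<^sup>2) x\<^sup>2\<close> and a small multiple of \<open>y\<^sup>2\<close>, and the contraction of
  \<open>y\<close> by \<open>\<rho>\<close> pays for the latter, with half of the gain to spare.\<close>

lemma lyapunov_step:
  fixes x y h \<rho> Q :: real
  assumes "0 \<le> \<rho>" "\<rho> < 1" "h\<^sup>2 \<le> Q"
  defines "K \<equiv> 2 / (1 - \<rho>) + (2 + Q) + 2 / (1 - \<rho>) * (1 + Q)\<^sup>2 + 1"
  shows "((1 + h\<^sup>2) * x + h * y)\<^sup>2 + (h * x + (\<rho> + h) * y)\<^sup>2
           \<le> (1 + K * h\<^sup>2) * (x\<^sup>2 + y\<^sup>2) - (1 - \<rho>) / 2 * y\<^sup>2"
proof -
  define k where "k = 1 - \<rho>"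
  have k: "k > 0" using assms by (simp add: k_def)
  define W where "W = x\<^sup>2 + y\<^sup>2"
  have W: "x\<^sup>2 \<le> W" "y\<^sup>2 \<le> W" "0 \<le> W" by (auto simp: W_def)
  have hx: "h\<^sup>2 * x\<^sup>2 \<le> h\<^sup>2 * W" "h\<^sup>2 * y\<^sup>2 \<le> h\<^sup>2 * W"
    using W by (auto intro: mult_left_mono)
  have Q0: "0 \<le> Q" using assms(3) zero_le_power2[of h] by linarith
  have "(h * x + (\<rho> + h) * y)\<^sup>2 = (\<rho> * y + h * (x + y))\<^sup>2" by (simp add: algebra_simps)
  also have "\<dots> \<le> \<rho> * y\<^sup>2 + (h * (x + y))\<^sup>2 / k"
    unfolding k_def by (rule square_convex_combination_le) (use assms in auto)
  also have "(h * (x + y))\<^sup>2 \<le> 2 * h\<^sup>2 * W"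
  proof -
    have "2 * h\<^sup>2 * W - (h * (x + y))\<^sup>2 = (h * (x - y))\<^sup>2"
      by (simp add: W_def power2_eq_square algebra_simps)
    then show ?thesis by (metis diff_ge_0_iff_ge zero_le_power2)
  qed
  finally have 1: "(h * x + (\<rho> + h) * y)\<^sup>2 \<le> \<rho> * y\<^sup>2 + 2 / k * (h\<^sup>2 * W)"
    using k by (simp add: divide_right_mono)
  \<comment> \<open>The weights are chosen so that \<open>y\<^sup>2\<close> is charged with half of the gain \<open>1 - \<rho>\<close>.\<close>
  have 2: "2 * ((1 + h\<^sup>2) * h * x) * y \<le> k / 2 * y\<^sup>2 + 2 / k * ((1 + h\<^sup>2) * h * x)\<^sup>2"
  proof -
    have "k / 2 * y\<^sup>2 + 2 / k * ((1 + h\<^sup>2) * h * x)\<^sup>2 - 2 * ((1 + h\<^sup>2) * h * x) * y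
            = 2 / k * ((1 + h\<^sup>2) * h * x - k / 2 * y)\<^sup>2"
      using k by (simp add: power2_eq_square field_simps)
    also have "\<dots> \<ge> 0" using k by simp
    finally show ?thesis by simp
  qed
  have "((1 + h\<^sup>2) * h * x)\<^sup>2 = (1 + h\<^sup>2)\<^sup>2 * (h\<^sup>2 * x\<^sup>2)" by (simp add: power_mult_distrib)
  also have "\<dots> \<le> (1 + Q)\<^sup>2 * (h\<^sup>2 * W)"
    by (rule mult_mono[OF power_mono hx(1)]) (use assms(3) Q0 in auto)
  finally have "2 / k * ((1 + h\<^sup>2) * h * x)\<^sup>2 \<le> 2 / k * ((1 + Q)\<^sup>2 * (h\<^sup>2 * W))"
    using k by (intro mult_left_mono) auto
  with 2 have 3: "2 * ((1 + h\<^sup>2) * h * x) * y \<le> k / 2 * y\<^sup>2 + 2 / k * (1 + Q)\<^sup>2 * (h\<^sup>2 * W)"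
    by (simp add: mult.assoc)
  have "(2 + h\<^sup>2) * (h\<^sup>2 * x\<^sup>2) \<le> (2 + Q) * (h\<^sup>2 * W)"
    by (rule mult_mono[OF _ hx(1)]) (use assms(3) Q0 in auto)
  then have 4: "((1 + h\<^sup>2) * x)\<^sup>2 \<le> x\<^sup>2 + (2 + Q) * (h\<^sup>2 * W)"
    by (simp add: power2_eq_square algebra_simps)
  have "((1 + h\<^sup>2) * x + h * y)\<^sup>2 = ((1 + h\<^sup>2) * x)\<^sup>2 + 2 * ((1 + h\<^sup>2) * h * x) * y + h\<^sup>2 * y\<^sup>2"
    by (simp add: power2_eq_square algebra_simps)
  with 1 3 4 hx(2) have "((1 + h\<^sup>2) * x + h * y)\<^sup>2 + (h * x + (\<rho> + h) * y)\<^sup>2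
      \<le> x\<^sup>2 + (2 + Q) * (h\<^sup>2 * W) + (k / 2 * y\<^sup>2 + 2 / k * (1 + Q)\<^sup>2 * (h\<^sup>2 * W)) + h\<^sup>2 * W
          + (\<rho> * y\<^sup>2 + 2 / k * (h\<^sup>2 * W))" by linarith
  also have "\<dots> = (x\<^sup>2 + k / 2 * y\<^sup>2 + \<rho> * y\<^sup>2) + K * h\<^sup>2 * W"
    unfolding K_def k_def[symmetric] by (simp add: algebra_simps)
  also have "x\<^sup>2 + k / 2 * y\<^sup>2 + \<rho> * y\<^sup>2 = W - k / 2 * y\<^sup>2"
    by (simp add: W_def k_def field_simps)
  also have "W - k / 2 * y\<^sup>2 + K * h\<^sup>2 * W = (1 + K * h\<^sup>2) * W - k / 2 * y\<^sup>2"
    by (simp add: algebra_simps)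
  finally show ?thesis by (simp add: W_def k_def)
qed

text \<open>With square summable \<open>h\<close> the energy stays bounded. The surplus in its decay makes \<open>y\<close> square
  summable, and \<open>x\<close> is increasing, so that boundedness is convergence.\<close>

lemma perturbed_real_system:
  fixes x y h :: "nat \<Rightarrow> real" and \<rho> :: real
  assumes \<rho>: "0 \<le> \<rho>" "\<rho> < 1"
    and h: "\<And>n. 0 \<le> h n" "summable (\<lambda>n. (h n)\<^sup>2)"
    and x0: "0 \<le> x 0" and y0: "0 \<le> y 0"
    and x_Suc: "\<And>n. x (Suc n) = (1 + (h n)\<^sup>2) * x n + h n * y n"
    and y_Suc: "\<And>n. y (Suc n) = h n * x n + (\<rho> + h n) * y n"
  shows "incseq x" "convergent x" "y \<longlonglongrightarrow> 0"
proof -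
  have nonneg: "0 \<le> x n \<and> 0 \<le> y n" for n
    by (induction n) (use x0 y0 x_Suc y_Suc h \<rho> in auto)
  show inc: "incseq x"
  proof (rule incseq_SucI)
    fix n show "x n \<le> x (Suc n)"
      using nonneg[of n] h(1)[of n] by (simp add: x_Suc algebra_simps)
  qed
  obtain Q where Q: "\<And>n. (h n)\<^sup>2 \<le> Q"
    using summable_imp_Bseq[OF h(2)] unfolding Bseq_def by auto
  define K where "K = 2 / (1 - \<rho>) + (2 + Q) + 2 / (1 - \<rho>) * (1 + Q)\<^sup>2 + 1"
  have "0 \<le> Q" using Q[of 0] zero_le_power2[of "h 0"] by linarith
  then have K: "0 \<le> K" using \<rho> by (simp add: K_def)
  define W where "W n = (x n)\<^sup>2 + (y n)\<^sup>2" for n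
  have W0: "0 \<le> W n" for n by (simp add: W_def)
  have step: "W (Suc n) \<le> (1 + K * (h n)\<^sup>2) * W n - (1 - \<rho>) / 2 * (y n)\<^sup>2" for n
    unfolding W_def x_Suc y_Suc K_def by (rule lyapunov_step) (use \<rho> Q in auto)
  define T where "T = (\<Sum>n. (h n)\<^sup>2)"
  have sum_le: "(\<Sum>k<n. (h k)\<^sup>2) \<le> T" for n
    unfolding T_def by (rule sum_le_suminf[OF h(2)]) auto
  have W_exp: "W n \<le> W 0 * exp (K * (\<Sum>k<n. (h k)\<^sup>2))" for n
  proof (induction n)
    case (Suc n)
    have "W (Suc n) \<le> (1 + K * (h n)\<^sup>2) * W n - (1 - \<rho>) / 2 * (y n)\<^sup>2" by (rule step)
    also have "\<dots> \<le> (1 + K * (h n)\<^sup>2) * W n" using \<rho> by simp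
    also have "\<dots> \<le> exp (K * (h n)\<^sup>2) * (W 0 * exp (K * (\<Sum>k<n. (h k)\<^sup>2)))"
      by (intro mult_mono Suc.IH exp_ge_add_one_self) (auto simp: W0)
    also have "\<dots> = W 0 * exp (K * (\<Sum>k<Suc n. (h k)\<^sup>2))"
      by (simp add: exp_add distrib_left)
    finally show ?case .
  qed simp
  define M where "M = W 0 * exp (K * T)"
  have W_le: "W n \<le> M" for n
  proof -
    have "W 0 * exp (K * (\<Sum>k<n. (h k)\<^sup>2)) \<le> M"
      unfolding M_def using K sum_le[of n] W0[of 0] by (intro mult_left_mono) (auto intro: mult_left_mono)
    with W_exp[of n] show ?thesis by linarith
  qed
  have "x n \<le> sqrt M" for n
    using W_le[of n] by (intro real_le_rsqrt) (simp add: W_def, smt (verit) zero_le_power2)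
  with inc show "convergent x"
    using incseq_convergent[of x "sqrt M"] unfolding convergent_def by metis
  have "(\<Sum>k<n. (1 - \<rho>) / 2 * (y k)\<^sup>2) \<le> W 0 + K * M * (\<Sum>k<n. (h k)\<^sup>2) - W n" for n
  proof (induction n)
    case (Suc n)
    have "K * (h n)\<^sup>2 * W n \<le> K * (h n)\<^sup>2 * M" using K W_le by (intro mult_left_mono) auto
    with step[of n] Suc show ?case by (simp add: algebra_simps)
  qed simp
  moreover have "K * M * (\<Sum>k<n. (h k)\<^sup>2) \<le> K * M * T" for n
    using K W0[of 0] sum_le[of n] by (intro mult_left_mono) (auto simp: M_def)
  ultimately have "(\<Sum>k<n. (1 - \<rho>) / 2 * (y k)\<^sup>2) \<le> W 0 + K * M * T" for n
    using W0[of n] by (smt (verit))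
  then have "summable (\<lambda>n. (1 - \<rho>) / 2 * (y n)\<^sup>2)"
    using \<rho> by (intro bounded_imp_summable[where B = "W 0 + K * M * T"])
      (auto simp: lessThan_Suc_atMost[symmetric] simp del: sum.lessThan_Suc)
  then have "summable (\<lambda>n. (y n)\<^sup>2)" using \<rho> by (simp add: summable_cmult_iff)
  then have "(\<lambda>n. (y n)\<^sup>2) \<longlonglongrightarrow> 0" by (rule summable_LIMSEQ_zero)
  then show "y \<longlonglongrightarrow> 0" by simp
qed

text \<open>The norms of \<open>Y\<close> and \<open>D\<close> are dominated, uniformly in the parameter \<open>z\<close>, by the solution \<open>(x, y)\<close>
  of the real system. Moreover the increments of \<open>Y\<close> are dominated by those of the convergent
  increasing sequence \<open>x\<close>, so the Weierstrass test yields uniform convergence.\<close>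

lemma perturbed_system_uniform_limit:
  fixes Y D :: "nat \<Rightarrow> 'z \<Rightarrow> complex" and h :: "nat \<Rightarrow> real"
  assumes \<rho>: "0 \<le> \<rho>" "\<rho> < 1"
    and h: "\<And>n. 0 \<le> h n" "summable (\<lambda>n. (h n)\<^sup>2)"
    and Y0: "\<And>z. z \<in> K \<Longrightarrow> norm (Y 0 z) \<le> M" and D0: "\<And>z. z \<in> K \<Longrightarrow> norm (D 0 z) \<le> M"
    and Y_Suc: "\<And>n z. z \<in> K \<Longrightarrow>
          norm (Y (Suc n) z - Y n z) \<le> (h n)\<^sup>2 * norm (Y n z) + h n * norm (D n z)"
    and D_Suc: "\<And>n z. z \<in> K \<Longrightarrow>
          norm (D (Suc n) z) \<le> h n * norm (Y n z) + (\<rho> + h n) * norm (D n z)"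
  obtains L B where "uniform_limit K Y L sequentially" "uniform_limit K D (\<lambda>_. 0) sequentially"
    "\<And>z. z \<in> K \<Longrightarrow> norm (L z) \<le> B"
proof -
  define s :: "nat \<Rightarrow> real \<times> real" where
    "s = rec_nat (\<bar>M\<bar>, \<bar>M\<bar>) (\<lambda>n (x, y). ((1 + (h n)\<^sup>2) * x + h n * y, h n * x + (\<rho> + h n) * y))"
  define x where "x n = fst (s n)" for n
  define y where "y n = snd (s n)" for n
  have x0: "x 0 = \<bar>M\<bar>" and y0: "y 0 = \<bar>M\<bar>" by (auto simp: x_def y_def s_def)
  have x_Suc: "x (Suc n) = (1 + (h n)\<^sup>2) * x n + h n * y n"
    and y_Suc: "y (Suc n) = h n * x n + (\<rho> + h n) * y n" for n
    by (auto simp: x_def y_def s_def split: prod.splits)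
  have inc: "incseq x" and conv: "convergent x" and y_lim: "y \<longlonglongrightarrow> 0"
    using perturbed_real_system[of \<rho> h x y] \<rho> h x0 y0 x_Suc y_Suc by auto
  have bd: "norm (Y n z) \<le> x n \<and> norm (D n z) \<le> y n" if z: "z \<in> K" for n z
  proof (induction n)
    case 0
    then show ?case using Y0[OF z] D0[OF z] by (auto simp: x0 y0)
  next
    case (Suc n)
    have "norm (Y (Suc n) z) \<le> norm (Y n z) + norm (Y (Suc n) z - Y n z)"
      by norm
    also have "\<dots> \<le> norm (Y n z) + ((h n)\<^sup>2 * norm (Y n z) + h n * norm (D n z))"
      using Y_Suc[OF z] by simp
    also have "\<dots> \<le> x n + ((h n)\<^sup>2 * x n + h n * y n)"
      using Suc h(1) by (intro add_mono mult_left_mono) auto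
    finally have 1: "norm (Y (Suc n) z) \<le> x (Suc n)" by (simp add: x_Suc algebra_simps)
    have "norm (D (Suc n) z) \<le> h n * norm (Y n z) + (\<rho> + h n) * norm (D n z)" by (rule D_Suc[OF z])
    also have "\<dots> \<le> y (Suc n)"
      unfolding y_Suc using Suc h(1) \<rho> by (intro add_mono mult_left_mono) auto
    finally show ?case using 1 by simp
  qed
  have incr: "norm (Y (Suc n) z - Y n z) \<le> x (Suc n) - x n" if z: "z \<in> K" for n z
  proof -
    have "(h n)\<^sup>2 * norm (Y n z) + h n * norm (D n z) \<le> (h n)\<^sup>2 * x n + h n * y n"
      using bd[OF z] h(1) by (intro add_mono mult_left_mono) auto
    with Y_Suc[OF z, of n] show ?thesis by (simp add: x_Suc algebra_simps)
  qed
  have "summable (\<lambda>n. x (Suc n) - x n)"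
    using conv telescope_summable by (auto simp: convergent_def)
  then have "uniform_limit K (\<lambda>n z. \<Sum>i<n. Y (Suc i) z - Y i z) (\<lambda>z. \<Sum>i. Y (Suc i) z - Y i z) sequentially"
    by (rule Weierstrass_m_test[rotated]) (use incr in auto)
  then have "uniform_limit K (\<lambda>n z. Y 0 z + (\<Sum>i<n. Y (Suc i) z - Y i z))
      (\<lambda>z. Y 0 z + (\<Sum>i. Y (Suc i) z - Y i z)) sequentially"
    by (intro uniform_limit_intros)
  moreover have "Y 0 z + (\<Sum>i<n. Y (Suc i) z - Y i z) = Y n z" for n z
    by (simp add: sum_lessThan_telescope[of "\<lambda>i. Y i z"])
  ultimately have lim: "uniform_limit K Y (\<lambda>z. Y 0 z + (\<Sum>i. Y (Suc i) z - Y i z)) sequentially"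
    by simp
  have D_lim: "uniform_limit K D (\<lambda>_. 0) sequentially"
  proof (rule uniform_limitI)
    fix e :: real assume "e > 0"
    with y_lim have "\<forall>\<^sub>F n in sequentially. y n < e" by (rule order_tendstoD)
    then show "\<forall>\<^sub>F n in sequentially. \<forall>z\<in>K. dist (D n z) 0 < e"
    proof eventually_elim
      case (elim n)
      show ?case
      proof
        fix z assume "z \<in> K"
        then have "norm (D n z) \<le> y n" using bd by blast
        then show "dist (D n z) 0 < e" using elim by simp
      qed
    qed
  qed
  obtain B where B: "x n \<le> B" for n
    using conv convergent_imp_Bseq[of x] unfolding Bseq_def by (auto simp: abs_le_iff)
  have "norm (Y 0 z + (\<Sum>i. Y (Suc i) z - Y i z)) \<le> B" if z: "z \<in> K" for z
  proof (rule Lim_bounded)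
    show "(\<lambda>n. norm (Y n z)) \<longlonglongrightarrow> norm (Y 0 z + (\<Sum>i. Y (Suc i) z - Y i z))"
      by (intro tendsto_norm tendsto_uniform_limitI[OF lim z])
    show "\<forall>n\<ge>0. norm (Y n z) \<le> B" using bd[OF z] B order_trans by blast
  qed
  with lim D_lim that show thesis by blast
qed

section \<open>Uniform convergence of the rescaled polynomials\<close>

text \<open>Diagonalising the free recurrence introduces factors that are singular only at \<open>z = 1\<close> and
  \<open>z = -1\<close>, hence bounded on smaller discs.\<close>

lemma disc_kernel_bounds:
  fixes z :: complex
  assumes "norm z \<le> r" "r < 1"
  shows "norm (z\<^sup>2) \<le> r\<^sup>2" "r\<^sup>2 < 1" "1 - z\<^sup>2 \<noteq> 0"
    "norm (1 / (1 - z\<^sup>2)) \<le> 1 / (1 - r\<^sup>2)" "norm (z\<^sup>2 / (1 - z\<^sup>2)) \<le> 1 / (1 - r\<^sup>2)"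
proof -
  have "0 \<le> r" using assms(1) norm_ge_zero order_trans by blast
  with assms(2) show r2: "r\<^sup>2 < 1" by (simp add: power_less_one_iff abs_square_less_1)
  show z2: "norm (z\<^sup>2) \<le> r\<^sup>2" using assms(1) by (simp add: norm_power power_mono)
  have "1 - r\<^sup>2 \<le> norm (1 - z\<^sup>2)" using z2 norm_triangle_ineq2[of 1 "z\<^sup>2"] by simp
  then show den: "norm (1 / (1 - z\<^sup>2)) \<le> 1 / (1 - r\<^sup>2)" and "1 - z\<^sup>2 \<noteq> 0"
    using r2 by (auto simp: norm_divide frac_le)
  have "norm (z\<^sup>2 / (1 - z\<^sup>2)) = norm (z\<^sup>2) * norm (1 / (1 - z\<^sup>2))" by (simp add: norm_divide)
  also have "\<dots> \<le> 1 * (1 / (1 - r\<^sup>2))" using den z2 r2 by (intro mult_mono) auto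
  finally show "norm (z\<^sup>2 / (1 - z\<^sup>2)) \<le> 1 / (1 - r\<^sup>2)" by simp
qed

text \<open>One step of the recurrence in adapted coordinates. Here \<open>v\<close> stands for \<open>v\<^sub>n\<close> and \<open>d\<close> for
  \<open>v\<^sub>n - v\<^sub>n\<^sub>-\<^sub>1\<close>. The unperturbed step has the eigenvalues \<open>1\<close> and \<open>z\<^sup>2\<close> with eigencoordinates
  \<open>v + c d\<close> and \<open>d\<close>. The perturbation multiplies the first coordinate by \<open>1 + w\<close>, where \<open>w\<close> is
  of first order in the parameters, so that its series may converge only conditionally. Multiplication with
  \<open>exp (- w)\<close> removes this term, since \<open>(1 + w) exp (- w) = 1 + O(w\<^sup>2)\<close>. What remains is of the
  form treated above: first order only in the entries that involve the contracted coordinate.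
  The factor \<open>E\<close> stands for the product of the exponentials of the earlier steps.\<close>

lemma conjugated_step:
  fixes z v d \<alpha> \<beta> E :: complex and r \<delta> \<Delta> :: real
  assumes z: "norm z \<le> r" and r: "r < 1"
    and small: "norm \<alpha> + norm \<beta> \<le> \<delta>" and bdd: "\<delta> \<le> \<Delta>"
  defines "\<kappa> \<equiv> 1 / (1 - r\<^sup>2)"
  defines "T \<equiv> exp (\<kappa> * \<Delta>)"
  defines "C \<equiv> 3 * T\<^sup>2 * (1 + \<kappa>)\<^sup>2"
  defines "e \<equiv> - (\<beta> * z + \<alpha> * z\<^sup>2)"
  defines "c \<equiv> z\<^sup>2 / (1 - z\<^sup>2)" and "w \<equiv> e / (1 - z\<^sup>2)"
  defines "d' \<equiv> (1 + \<alpha>) * z\<^sup>2 * d + e * v"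
  defines "Y \<equiv> E * (v + c * d)" and "D \<equiv> E * d"
    and "Y' \<equiv> E * exp (- w) * (v + d' + c * d')" and "D' \<equiv> E * exp (- w) * d'"
  shows "norm (Y' - Y) \<le> (C * \<delta>)\<^sup>2 * norm Y + C * \<delta> * norm D"
    and "norm D' \<le> C * \<delta> * norm Y + (r\<^sup>2 + C * \<delta>) * norm D"
proof -
  note bounds = disc_kernel_bounds[OF z r]
  have r2: "r\<^sup>2 < 1" and z2: "norm (z\<^sup>2) \<le> r\<^sup>2" and nz: "1 - z\<^sup>2 \<noteq> 0"
    and den: "norm (1 / (1 - z\<^sup>2)) \<le> \<kappa>" and nc: "norm c \<le> \<kappa>"
    using bounds by (simp_all add: \<kappa>_def c_def)
  have \<kappa>: "1 \<le> \<kappa>" using r2 by (simp add: \<kappa>_def)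
  have \<delta>: "0 \<le> \<delta>" "norm \<alpha> \<le> \<delta>" "norm \<beta> \<le> \<delta>"
    using small by (auto intro: order_trans[rotated] add_increasing add_increasing2)
  have T: "1 \<le> T" using \<kappa> \<delta> bdd by (simp add: T_def)
  have ne: "norm e \<le> \<delta>"
  proof -
    have "norm e \<le> norm \<beta> * norm z + norm \<alpha> * norm (z\<^sup>2)"
      unfolding e_def by (metis norm_minus_cancel norm_mult norm_triangle_ineq)
    also have "\<dots> \<le> norm \<beta> * 1 + norm \<alpha> * 1"
      using z2 z r r2 by (intro add_mono mult_left_mono) auto
    finally show ?thesis using small by simp
  qed
  have nw: "norm w \<le> \<kappa> * \<delta>"
  proof -
    have "norm w = norm (1 / (1 - z\<^sup>2)) * norm e" by (simp add: w_def norm_divide)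
    also have "\<dots> \<le> \<kappa> * \<delta>" using den ne \<kappa> by (intro mult_mono) auto
    finally show ?thesis .
  qed
  also have "\<kappa> * \<delta> \<le> \<kappa> * \<Delta>" using \<kappa> bdd by (intro mult_left_mono) auto
  finally have expw: "exp (norm w) \<le> T" by (simp add: T_def)
  have expmw: "norm (exp (- w)) \<le> T" by (metis norm_exp norm_minus_cancel expw order_trans)
  have expm1: "norm (exp (- w) - 1) \<le> T * (\<kappa> * \<delta>)"
  proof -
    have "norm (exp (- w) - 1) \<le> exp (norm w) * norm w"
      using Taylor_exp_field[of "- w" 0] by simp
    also have "\<dots> \<le> T * (\<kappa> * \<delta>)" using expw nw T by (intro mult_mono) auto
    finally show ?thesis .
  qed
  have exp2: "norm (exp (- w) * (1 + w) - 1) \<le> T * (T * (\<kappa> * \<delta>)\<^sup>2)"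
  proof -
    have "exp (- w) * (1 + w) - 1 = - (exp (- w) * (exp w - (\<Sum>i\<le>1. w ^ i / fact i)))"
      by (simp add: exp_minus field_simps)
    then have "norm (exp (- w) * (1 + w) - 1) = norm (exp (- w)) * norm (exp w - (\<Sum>i\<le>1. w ^ i / fact i))"
      by (simp only: norm_minus_cancel norm_mult)
    also have "\<dots> \<le> T * (exp (norm w) * norm w ^ 2)"
      using Taylor_exp_field[of w 1] expmw T by (intro mult_mono) (auto simp: numeral_2_eq_2)
    also have "\<dots> \<le> T * (T * (\<kappa> * \<delta>)\<^sup>2)"
      using expw nw T by (intro mult_left_mono mult_mono power_mono) auto
    finally show ?thesis .
  qed
  have coef: "norm (c * (\<alpha> - w)) \<le> \<kappa> * ((1 + \<kappa>) * \<delta>)"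
  proof -
    have "norm (\<alpha> - w) \<le> \<delta> + \<kappa> * \<delta>" using norm_triangle_ineq4[of \<alpha> w] nw \<delta>(2) by linarith
    then show ?thesis unfolding norm_mult using nc \<kappa> by (intro mult_mono) (auto simp: algebra_simps)
  qed
  have coef2: "norm (\<alpha> * z\<^sup>2 - e * c) \<le> (1 + \<kappa>) * \<delta>"
  proof -
    have "norm (\<alpha> * z\<^sup>2 - e * c) \<le> norm \<alpha> * norm (z\<^sup>2) + norm e * norm c"
      by (metis norm_triangle_ineq4 norm_mult)
    also have "\<dots> \<le> \<delta> * 1 + \<delta> * \<kappa>"
      using \<delta> ne nc z2 r2 by (intro add_mono mult_mono) auto
    finally show ?thesis by (simp add: algebra_simps)
  qed
  have C: "0 \<le> C" "T * T * \<kappa>\<^sup>2 \<le> C\<^sup>2" "T * (\<kappa> * (1 + \<kappa>)) \<le> C" "T \<le> C" "T * \<kappa> + T * (1 + \<kappa>) \<le> C"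
  proof -
    have T2: "T \<le> T\<^sup>2" using T by (simp add: power2_eq_square)
    show C0: "0 \<le> C" by (simp add: C_def)
    have \<kappa>2: "1 \<le> (1 + \<kappa>)\<^sup>2" "\<kappa> * (1 + \<kappa>) \<le> (1 + \<kappa>)\<^sup>2" "\<kappa> + (1 + \<kappa>) \<le> (1 + \<kappa>)\<^sup>2"
      using \<kappa> by (auto simp: power2_eq_square algebra_simps) 
    have TC: "T * s \<le> C" if "0 \<le> s" "s \<le> (1 + \<kappa>)\<^sup>2" for s
    proof -
      have "T * s \<le> T\<^sup>2 * (1 + \<kappa>)\<^sup>2" using T2 that by (intro mult_mono) auto
      also have "\<dots> \<le> C" by (simp add: C_def)
      finally show ?thesis .
    qed
    show "T * (\<kappa> * (1 + \<kappa>)) \<le> C" "T \<le> C" "T * \<kappa> + T * (1 + \<kappa>) \<le> C"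
      using TC[of "\<kappa> * (1 + \<kappa>)"] TC[of 1] TC[of "\<kappa> + (1 + \<kappa>)"] \<kappa> \<kappa>2 by (auto simp: distrib_left)
    have "T * \<kappa> \<le> C" using TC[of \<kappa>] \<kappa> \<kappa>2 by linarith
    then have "(T * \<kappa>)\<^sup>2 \<le> C\<^sup>2" using T \<kappa> by (intro power_mono) auto
    then show "T * T * \<kappa>\<^sup>2 \<le> C\<^sup>2" by (simp add: power2_eq_square mult_ac)
  qed
  have c1: "1 + c = 1 / (1 - z\<^sup>2)" using nz by (simp add: c_def field_simps)
  have dec: "v + d' + c * d' = (1 + w) * (v + c * d) + c * (\<alpha> - w) * d"
  proof -
    have "v + d' + c * d' = v + (1 + c) * d'" by (simp add: algebra_simps)
    also have "\<dots> = v + d' / (1 - z\<^sup>2)" unfolding c1 by simp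
    also have "\<dots> = v + (1 + \<alpha>) * c * d + w * v"
      by (simp add: d'_def c_def w_def add_divide_distrib)
    finally show ?thesis by (simp add: algebra_simps)
  qed
  have "Y' - Y = (exp (- w) * (1 + w) - 1) * Y + exp (- w) * (c * (\<alpha> - w)) * D"
    unfolding Y'_def dec Y_def D_def by (simp add: algebra_simps)
  then have "norm (Y' - Y) \<le> norm (exp (- w) * (1 + w) - 1) * norm Y + norm (exp (- w)) * norm (c * (\<alpha> - w)) * norm D"
    by (metis norm_triangle_ineq norm_mult)
  also have "\<dots> \<le> T * (T * (\<kappa> * \<delta>)\<^sup>2) * norm Y + T * (\<kappa> * ((1 + \<kappa>) * \<delta>)) * norm D"
    using exp2 expmw coef T by (intro add_mono mult_right_mono mult_mono) auto
  also have "\<dots> = (T * T * \<kappa>\<^sup>2) * (\<delta>\<^sup>2 * norm Y) + (T * (\<kappa> * (1 + \<kappa>))) * (\<delta> * norm D)"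
    by (simp add: power_mult_distrib mult_ac)
  also have "\<dots> \<le> C\<^sup>2 * (\<delta>\<^sup>2 * norm Y) + C * (\<delta> * norm D)"
    using C \<delta> by (intro add_mono mult_right_mono) auto
  finally show "norm (Y' - Y) \<le> (C * \<delta>)\<^sup>2 * norm Y + C * \<delta> * norm D"
    by (simp add: power_mult_distrib mult_ac)
  have "D' = exp (- w) * e * Y + (z\<^sup>2 + (exp (- w) - 1) * z\<^sup>2 + exp (- w) * (\<alpha> * z\<^sup>2 - e * c)) * D"
    unfolding D'_def d'_def Y_def D_def by (simp add: algebra_simps)
  then have "norm D' \<le> norm (exp (- w)) * norm e * norm Y
      + norm (z\<^sup>2 + (exp (- w) - 1) * z\<^sup>2 + exp (- w) * (\<alpha> * z\<^sup>2 - e * c)) * norm D"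
    by (metis norm_triangle_ineq norm_mult)
  also have "\<dots> \<le> T * \<delta> * norm Y + (r\<^sup>2 + T * (\<kappa> * \<delta>) * 1 + T * ((1 + \<kappa>) * \<delta>)) * norm D"
  proof (intro add_mono mult_right_mono mult_mono)
    have "norm (z\<^sup>2 + (exp (- w) - 1) * z\<^sup>2 + exp (- w) * (\<alpha> * z\<^sup>2 - e * c))
      \<le> norm (z\<^sup>2) + norm (exp (- w) - 1) * norm (z\<^sup>2) + norm (exp (- w)) * norm (\<alpha> * z\<^sup>2 - e * c)"
      by (metis (no_types, lifting) norm_triangle_ineq norm_mult add_right_mono order_trans)
    also have "\<dots> \<le> r\<^sup>2 + T * (\<kappa> * \<delta>) * 1 + T * ((1 + \<kappa>) * \<delta>)"
      using expm1 expmw coef2 z2 r2 T \<kappa> \<delta> by (intro add_mono mult_mono) auto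
    finally show "norm (z\<^sup>2 + (exp (- w) - 1) * z\<^sup>2 + exp (- w) * (\<alpha> * z\<^sup>2 - e * c))
      \<le> r\<^sup>2 + T * (\<kappa> * \<delta>) * 1 + T * ((1 + \<kappa>) * \<delta>)" .
  qed (use expmw ne T in auto)
  also have "\<dots> = T * (\<delta> * norm Y) + r\<^sup>2 * norm D + (T * \<kappa> + T * (1 + \<kappa>)) * (\<delta> * norm D)"
    by (simp add: algebra_simps)
  also have "\<dots> \<le> C * (\<delta> * norm Y) + r\<^sup>2 * norm D + C * (\<delta> * norm D)"
    using C \<delta> by (intro add_mono mult_right_mono) auto
  finally show "norm D' \<le> C * \<delta> * norm Y + (r\<^sup>2 + C * \<delta>) * norm D"
    by (simp add: algebra_simps)
qed

text \<open>The exponents \<open>w\<close> are linear in the parameters with coefficients that depend only on \<open>z\<close>, so their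
  partial sums \<open>S\<close> converge uniformly as soon as the two scalar series converge, absolutely or
  not. Undoing the normalisation by \<open>exp (- S)\<close> and the change of coordinates in the uniform limit
  of \<open>(Y, D)\<close> gives the claim.\<close>

lemma monic_rescaled_uniform_limit:
  fixes a b :: "nat \<Rightarrow> real" and r :: real
  assumes a: "\<And>n. n \<ge> 1 \<Longrightarrow> a n > 0" and r: "0 \<le> r" "r < 1"
    and sq: "summable (\<lambda>n. (\<bar>(a (n + 1))\<^sup>2 - 1\<bar> + \<bar>b (n + 2)\<bar>)\<^sup>2)"
    and convA: "convergent (\<lambda>n. \<Sum>k<n. (a (k + 1))\<^sup>2 - 1)"
    and convB: "convergent (\<lambda>n. \<Sum>k<n. b (k + 2))"
  obtains L where "uniform_limit (cball 0 r) (\<lambda>n. poly (monic_rescaled a b n)) L sequentially"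
    "bounded (L ` cball 0 r)"
proof -
  define K where "K = cball (0 :: complex) r"
  have K: "norm z \<le> r" if "z \<in> K" for z using that by (simp add: K_def)
  have r2: "r\<^sup>2 < 1" using r by (simp add: power_less_one_iff abs_square_less_1)
  define \<alpha> where "\<alpha> n = (a (n + 1))\<^sup>2 - 1" for n
  define \<beta> where "\<beta> n = b (n + 2)" for n
  define \<delta> where "\<delta> n = \<bar>\<alpha> n\<bar> + \<bar>\<beta> n\<bar>" for n
  have \<delta>sq: "summable (\<lambda>n. (\<delta> n)\<^sup>2)" using sq by (simp add: \<delta>_def \<alpha>_def \<beta>_def)
  then obtain Q where Q: "\<And>n. (\<delta> n)\<^sup>2 \<le> Q"
    using summable_imp_Bseq unfolding Bseq_def by (metis abs_of_nonneg real_norm_def zero_le_power2)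
  define \<Delta> where "\<Delta> = sqrt Q"
  have \<Delta>: "\<delta> n \<le> \<Delta>" for n unfolding \<Delta>_def by (rule real_le_rsqrt[OF Q])
  define \<kappa> where "\<kappa> = 1 / (1 - r\<^sup>2)"
  define C where "C = 3 * (exp (\<kappa> * \<Delta>))\<^sup>2 * (1 + \<kappa>)\<^sup>2"
  have C0: "0 \<le> C" by (simp add: C_def)
  \<comment> \<open>The index is shifted by one, so that the three-term recurrence applies from the start.\<close>
  define v where "v n z = poly (monic_rescaled a b (Suc n)) z" for n z
  define d where "d n z = v n z - poly (monic_rescaled a b n) z" for n z
  define c where "c z = z\<^sup>2 / (1 - z\<^sup>2)" for z :: complex
  define w where "w n z = - (of_real (\<beta> n) * z + of_real (\<alpha> n) * z\<^sup>2) / (1 - z\<^sup>2)" for n and z :: complex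
  define S where "S n z = (\<Sum>k<n. w k z)" for n z
  define Y where "Y n z = exp (- S n z) * (v n z + c z * d n z)" for n z
  define D where "D n z = exp (- S n z) * d n z" for n z
  have d_Suc: "d (Suc n) z = (1 + of_real (\<alpha> n)) * z\<^sup>2 * d n z
      + (- (of_real (\<beta> n) * z + of_real (\<alpha> n) * z\<^sup>2)) * v n z"
    and v_Suc: "v (Suc n) z = v n z + d (Suc n) z" for n z
    using poly_monic_rescaled_Suc_Suc[of a n b z] a[of "n + 2"]
    by (simp_all add: d_def v_def \<alpha>_def \<beta>_def power2_eq_square algebra_simps)
  have YS: "Y (Suc n) z = exp (- S n z) * exp (- w n z) * (v n z + d (Suc n) z + c z * d (Suc n) z)"
    and DS: "D (Suc n) z = exp (- S n z) * exp (- w n z) * d (Suc n) z" for n z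
    by (simp_all add: Y_def D_def S_def v_Suc flip: exp_add)
  have small: "norm (complex_of_real (\<alpha> n)) + norm (complex_of_real (\<beta> n)) \<le> \<delta> n" for n
    by (simp add: \<delta>_def)
  have Y_step: "norm (Y (Suc n) z - Y n z) \<le> (C * \<delta> n)\<^sup>2 * norm (Y n z) + C * \<delta> n * norm (D n z)"
    and D_step: "norm (D (Suc n) z) \<le> C * \<delta> n * norm (Y n z) + (r\<^sup>2 + C * \<delta> n) * norm (D n z)"
    if "z \<in> K" for n z
    using conjugated_step[OF K[OF that] r(2) small[of n] \<Delta>[of n], where E = "exp (- S n z)" and v = "v n z" and d = "d n z"]
    unfolding YS DS d_Suc unfolding Y_def D_def C_def \<kappa>_def c_def w_def by simp_all
  define M where "M = (3 + \<bar>b 1\<bar>) * (1 + \<kappa>)"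
  have \<kappa>: "1 \<le> \<kappa>" using r2 by (simp add: \<kappa>_def)
  have den: "norm (1 / (1 - z\<^sup>2)) \<le> \<kappa>" and nc: "norm (c z) \<le> \<kappa>" if "z \<in> K" for z
    using disc_kernel_bounds(4,5)[OF K[OF that] r(2)] by (simp_all add: \<kappa>_def c_def)
  have init: "norm (v 0 z) \<le> 2 + \<bar>b 1\<bar>" "norm (d 0 z) \<le> 2 + \<bar>b 1\<bar>" if "z \<in> K" for z
  proof -
    have z: "norm z \<le> 1" using K[OF that] r by linarith
    have nbz: "norm (b 1 * z) \<le> \<bar>b 1\<bar> * 1" unfolding norm_mult using z by (intro mult_mono) auto
    have nz2: "norm (z\<^sup>2) \<le> 1" using z by (simp add: norm_power power_le_one)
    have d0: "d 0 z = z\<^sup>2 - b 1 * z" and v0: "v 0 z = 1 + d 0 z"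
      using monic_rescaled_1[of a b] a[of 1] by (simp_all add: d_def v_def power2_eq_square algebra_simps)
    show "norm (d 0 z) \<le> 2 + \<bar>b 1\<bar>"
      unfolding d0 using norm_triangle_ineq4[of "z\<^sup>2" "b 1 * z"] nbz nz2 by simp
    have "norm (d 0 z) \<le> 1 + \<bar>b 1\<bar>"
      unfolding d0 using norm_triangle_ineq4[of "z\<^sup>2" "b 1 * z"] nbz nz2 by simp
    then show "norm (v 0 z) \<le> 2 + \<bar>b 1\<bar>"
      unfolding v0 using norm_triangle_ineq[of 1 "d 0 z"] by simp
  qed
  have Y0: "norm (Y 0 z) \<le> M" and D0: "norm (D 0 z) \<le> M" if "z \<in> K" for z
  proof -
    have "norm (Y 0 z) \<le> norm (v 0 z) + norm (c z) * norm (d 0 z)"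
      by (simp add: Y_def S_def) (metis norm_triangle_ineq norm_mult)
    also have "\<dots> \<le> (2 + \<bar>b 1\<bar>) + \<kappa> * (2 + \<bar>b 1\<bar>)"
      using init[OF that] nc[OF that] \<kappa> by (intro add_mono mult_mono) auto
    also have "\<dots> = (2 + \<bar>b 1\<bar>) * (1 + \<kappa>)" by (simp add: algebra_simps)
    also have "\<dots> \<le> M" unfolding M_def using \<kappa> by (intro mult_right_mono) auto
    finally show "norm (Y 0 z) \<le> M" .
    have "norm (D 0 z) \<le> (2 + \<bar>b 1\<bar>) * 1" using init(2)[OF that] by (simp add: D_def S_def)
    also have "\<dots> \<le> M" unfolding M_def using \<kappa> by (intro mult_mono) auto
    finally show "norm (D 0 z) \<le> M" .
  qed
  have hsq: "summable (\<lambda>n. (C * \<delta> n)\<^sup>2)" using \<delta>sq by (simp add: power_mult_distrib summable_mult)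
  have \<delta>0: "0 \<le> C * \<delta> n" for n using C0 by (simp add: \<delta>_def)
  obtain L B where Y_lim: "uniform_limit K Y L sequentially"
    and D_lim: "uniform_limit K D (\<lambda>_. 0) sequentially" and B: "\<And>z. z \<in> K \<Longrightarrow> norm (L z) \<le> B"
    by (rule perturbed_system_uniform_limit[of "r\<^sup>2" "\<lambda>n. C * \<delta> n" K Y M D,
          OF zero_le_power2 r2 \<delta>0 hsq Y0 D0 Y_step D_step]) (blast intro: that)+
  obtain A1 B1 where A1: "(\<lambda>n. \<Sum>k<n. \<alpha> k) \<longlonglongrightarrow> A1" and B1: "(\<lambda>n. \<Sum>k<n. \<beta> k) \<longlonglongrightarrow> B1"
    using convA convB by (auto simp: convergent_def \<alpha>_def \<beta>_def)
  define s1 where "s1 z = - z / (1 - z\<^sup>2)" for z :: complex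
  define Slim where "Slim z = of_real B1 * s1 z + of_real A1 * (- c z)" for z
  have s1_bd: "norm (s1 z) \<le> \<kappa>" if "z \<in> K" for z
  proof -
    have "norm (s1 z) = norm z * norm (1 / (1 - z\<^sup>2))" by (simp add: s1_def norm_divide)
    also have "\<dots> \<le> 1 * \<kappa>" using den[OF that] K[OF that] r \<kappa> by (intro mult_mono) auto
    finally show ?thesis by simp
  qed
  have bnd_s1: "bounded (s1 ` K)" and bnd_c: "bounded ((\<lambda>z. - c z) ` K)"
    using s1_bd nc by (auto simp: bounded_iff)
  have const: "uniform_limit K (\<lambda>n _. complex_of_real (f n)) (\<lambda>_. of_real l) sequentially"
    if "f \<longlonglongrightarrow> l" for f :: "nat \<Rightarrow> real" and l
    using that by (intro uniform_limitI) (auto simp: tendsto_iff dist_of_real elim!: eventually_mono)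
  have "uniform_limit K (\<lambda>n z. of_real (\<Sum>k<n. \<beta> k) * s1 z + of_real (\<Sum>k<n. \<alpha> k) * (- c z)) Slim sequentially"
    unfolding Slim_def
    by (intro uniform_limit_add uniform_lim_mult const A1 B1 uniform_limit_const bnd_s1 bnd_c)
      (auto simp: bounded_iff)
  moreover have "of_real (\<Sum>k<n. \<beta> k) * s1 z + of_real (\<Sum>k<n. \<alpha> k) * (- c z) = S n z" for n z
  proof -
    have "w k z = of_real (\<beta> k) * s1 z + of_real (\<alpha> k) * (- c z)" for k
      by (simp add: w_def s1_def c_def add_divide_distrib diff_divide_distrib)
    then show ?thesis by (simp add: S_def sum.distrib sum_distrib_right sum_negf sum_subtractf)
  qed
  ultimately have S_lim: "uniform_limit K S Slim sequentially" by simp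
  define R where "R = (\<bar>B1\<bar> + \<bar>A1\<bar>) * \<kappa>"
  have Slim_bd: "norm (Slim z) \<le> R" if "z \<in> K" for z
  proof -
    have "norm (Slim z) \<le> \<bar>B1\<bar> * norm (s1 z) + \<bar>A1\<bar> * norm (c z)"
      unfolding Slim_def by (rule order_trans[OF norm_triangle_ineq]) (simp add: norm_mult)
    also have "\<dots> \<le> \<bar>B1\<bar> * \<kappa> + \<bar>A1\<bar> * \<kappa>"
      using s1_bd[OF that] nc[OF that] by (intro add_mono mult_left_mono) auto
    finally show ?thesis by (simp add: R_def algebra_simps)
  qed
  have E_lim: "uniform_limit K (\<lambda>n z. exp (S n z)) (\<lambda>z. exp (Slim z)) sequentially"
  proof (rule uniform_limit_compose_uniformly_continuous_on[OF S_lim])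
    show "uniformly_continuous_on (cball 0 (R + 1)) (exp :: complex \<Rightarrow> complex)"
      by (intro compact_uniformly_continuous continuous_intros) auto
    have "\<forall>\<^sub>F n in sequentially. \<forall>z\<in>K. dist (S n z) (Slim z) < 1"
      using S_lim by (rule uniform_limitD) simp
    then show "\<forall>\<^sub>F n in sequentially. \<forall>z\<in>K. S n z \<in> cball 0 (R + 1)"
    proof eventually_elim
      case (elim n)
      show ?case
      proof
        fix z assume z: "z \<in> K"
        have "norm (S n z) \<le> norm (Slim z) + dist (S n z) (Slim z)" unfolding dist_norm by norm
        with elim z Slim_bd[OF z] show "S n z \<in> cball 0 (R + 1)" by fastforce
      qed
    qed
  qed auto
  have E_bd: "norm (exp (Slim z)) \<le> exp R" if "z \<in> K" for z
    using norm_exp[of "Slim z"] Slim_bd[OF that] by (meson exp_le_cancel_iff order_trans)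
  have bnd_E: "bounded ((\<lambda>z. exp (Slim z)) ` K)"
    using E_bd unfolding bounded_iff by blast
  have bnd_L: "bounded (L ` K)" using B by (auto simp: bounded_iff)
  have "uniform_limit K (\<lambda>n z. exp (S n z) * (Y n z + (- c z) * D n z))
      (\<lambda>z. exp (Slim z) * (L z + (- c z) * 0)) sequentially"
    by (intro uniform_lim_mult uniform_limit_add E_lim Y_lim D_lim uniform_limit_const bnd_E bnd_c)
      (use bnd_L in \<open>auto simp: bounded_iff\<close>)
  moreover have "exp (S n z) * (Y n z + (- c z) * D n z) = poly (monic_rescaled a b (Suc n)) z" for n z
    by (simp add: Y_def D_def v_def[symmetric] exp_minus field_simps)
  ultimately have "uniform_limit K (\<lambda>n. poly (monic_rescaled a b (Suc n))) (\<lambda>z. exp (Slim z) * L z) sequentially"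
    by simp
  then have "uniform_limit K (\<lambda>n. poly (monic_rescaled a b n)) (\<lambda>z. exp (Slim z) * L z) sequentially"
    using filterlim_sequentially_Suc[of "\<lambda>n. poly (monic_rescaled a b n)"] by blast
  moreover have "bounded ((\<lambda>z. exp (Slim z) * L z) ` K)"
  proof (rule boundedI)
    fix y assume "y \<in> (\<lambda>z. exp (Slim z) * L z) ` K"
    then obtain z where z: "z \<in> K" "y = exp (Slim z) * L z" by blast
    show "norm y \<le> exp R * B"
      unfolding z(2) norm_mult using E_bd[OF z(1)] B[OF z(1)] by (intro mult_mono) auto
  qed
  ultimately show thesis using that unfolding K_def by blast
qed

text \<open>The recurrence contains \<open>a\<^sub>n\<^sup>2 - 1\<close>. Its series converges because
  \<open>a\<^sup>2 - 1 = 2 ln a + O((a - 1)\<^sup>2)\<close>, where the logarithms sum to the logarithm of the limit of the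
  product.\<close>

lemma parameters_conditionally_summable:
  fixes a b :: "nat \<Rightarrow> real"
  assumes a: "\<And>n. n \<ge> 1 \<Longrightarrow> a n > 0" and a1: "a \<longlonglongrightarrow> 1"
    and sq: "summable (\<lambda>n. \<bar>a (Suc n) - 1\<bar>\<^sup>2 + \<bar>b (Suc n)\<bar>\<^sup>2)"
    and l: "l \<noteq> 0" "(\<lambda>n. \<Prod>j=1..n. a j) \<longlonglongrightarrow> l"
    and b: "convergent (\<lambda>n. \<Sum>j=1..n. b j)"
  shows "summable (\<lambda>n. (\<bar>(a (n + 1))\<^sup>2 - 1\<bar> + \<bar>b (n + 2)\<bar>)\<^sup>2)"
    and "convergent (\<lambda>n. \<Sum>k<n. (a (k + 1))\<^sup>2 - 1)"
    and "convergent (\<lambda>n. \<Sum>k<n. b (k + 2))"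
proof -
  have sqa: "summable (\<lambda>n. (a (Suc n) - 1)\<^sup>2)"
    by (rule summable_comparison_test'[OF sq, of 0]) auto
  have sqb: "summable (\<lambda>n. (b (Suc n))\<^sup>2)"
    by (rule summable_comparison_test'[OF sq, of 0]) auto
  then have sqb2: "summable (\<lambda>n. (b (n + 2))\<^sup>2)"
    using summable_Suc_iff[of "\<lambda>n. (b (Suc n))\<^sup>2"] by simp
  have aS: "(\<lambda>n. a (Suc n)) \<longlonglongrightarrow> 1" using a1 by (rule LIMSEQ_Suc)
  have ev: "\<forall>\<^sub>F n in sequentially. 2 / 3 < a (Suc n)" "\<forall>\<^sub>F n in sequentially. a (Suc n) < 2"
    using order_tendstoD(1)[OF aS, of "2 / 3"] order_tendstoD(2)[OF aS, of 2] by auto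
  have "summable (\<lambda>n. 2 * (9 * (a (Suc n) - 1)\<^sup>2) + 2 * (b (n + 2))\<^sup>2)"
    by (intro summable_add summable_mult sqa sqb2)
  then show "summable (\<lambda>n. (\<bar>(a (n + 1))\<^sup>2 - 1\<bar> + \<bar>b (n + 2)\<bar>)\<^sup>2)"
  proof (rule summable_comparison_test_ev[rotated])
    show "\<forall>\<^sub>F n in sequentially. norm ((\<bar>(a (n + 1))\<^sup>2 - 1\<bar> + \<bar>b (n + 2)\<bar>)\<^sup>2)
            \<le> 2 * (9 * (a (Suc n) - 1)\<^sup>2) + 2 * (b (n + 2))\<^sup>2"
      using ev
    proof eventually_elim
      case (elim n)
      have "(a (n + 1))\<^sup>2 - 1 = (a (n + 1) + 1) * (a (n + 1) - 1)"
        by (simp add: power2_eq_square algebra_simps)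
      then have "((a (n + 1))\<^sup>2 - 1)\<^sup>2 = (a (n + 1) + 1)\<^sup>2 * (a (n + 1) - 1)\<^sup>2"
        by (simp only: power_mult_distrib)
      also have "\<dots> \<le> 3\<^sup>2 * (a (n + 1) - 1)\<^sup>2"
        using elim by (intro mult_right_mono power_mono) auto
      finally have A: "((a (n + 1))\<^sup>2 - 1)\<^sup>2 \<le> 9 * (a (n + 1) - 1)\<^sup>2" by simp
      have "(\<bar>x\<bar> + \<bar>y\<bar>)\<^sup>2 \<le> 2 * x\<^sup>2 + 2 * y\<^sup>2" for x y :: real
        using sum_squares_bound[of "\<bar>x\<bar>" "\<bar>y\<bar>"] by (simp add: power2_sum)
      from this[of "(a (n + 1))\<^sup>2 - 1" "b (n + 2)"] A show ?case by simp
    qed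
  qed
  have "summable (\<lambda>n. (a (Suc n))\<^sup>2 - 1 - 2 * ln (a (Suc n)))"
  proof (rule summable_comparison_test_ev[OF _ summable_mult[OF sqa, of 4]])
    show "\<forall>\<^sub>F n in sequentially. norm ((a (Suc n))\<^sup>2 - 1 - 2 * ln (a (Suc n))) \<le> 4 * (a (Suc n) - 1)\<^sup>2"
      using ev(1)
    proof eventually_elim
      case (elim n)
      have "0 \<le> (a (Suc n) - 1)\<^sup>2" by simp
      also have "\<dots> \<le> (a (Suc n))\<^sup>2 - 1 - 2 * ln (a (Suc n))"
        using a by (intro square_minus_1_minus_2_ln_ge) auto
      finally show ?case using square_minus_1_minus_2_ln_le[of "a (Suc n)"] elim by simp
    qed
  qed
  then have entropy: "convergent (\<lambda>n. \<Sum>k<n. (a (Suc k))\<^sup>2 - 1 - 2 * ln (a (Suc k)))"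
    by (simp add: summable_iff_convergent)
  have "(\<lambda>n. ln (\<Prod>j=1..n. a j)) \<longlonglongrightarrow> ln l" by (rule tendsto_ln[OF l(2,1)])
  moreover have "ln (\<Prod>j=1..n. a j) = (\<Sum>k<n. ln (a (Suc k)))" for n
    using ln_prod_parameters[of a n] a by (simp add: sum.atLeast1_atMost_eq)
  ultimately have "convergent (\<lambda>n. \<Sum>k<n. ln (a (Suc k)))"
    unfolding convergent_def by auto
  then have "convergent (\<lambda>n. 2 * (\<Sum>k<n. ln (a (Suc k))))" by (intro convergent_mult convergent_const)
  from convergent_add[OF entropy this]
  show "convergent (\<lambda>n. \<Sum>k<n. (a (k + 1))\<^sup>2 - 1)"
    by (simp add: sum_distrib_left flip: sum.distrib)
  have "convergent (\<lambda>n. (\<Sum>j=1..Suc n. b j) - b 1)"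
    using b convergent_Suc_iff[of "\<lambda>n. \<Sum>j=1..n. b j"] by (intro convergent_diff convergent_const) blast
  moreover have "(\<Sum>j=1..Suc n. b j) - b 1 = (\<Sum>k<n. b (k + 2))" for n
    by (induction n) auto
  ultimately show "convergent (\<lambda>n. \<Sum>k<n. b (k + 2))" by simp
qed

lemma rescaled_poly_uniform_limit:
  fixes a b :: "nat \<Rightarrow> real"
  assumes a: "\<And>n. n \<ge> 1 \<Longrightarrow> a n > 0" and a1: "a \<longlonglongrightarrow> 1"
    and sq: "summable (\<lambda>n. \<bar>a (Suc n) - 1\<bar>\<^sup>2 + \<bar>b (Suc n)\<bar>\<^sup>2)"
    and l: "l \<noteq> 0" "(\<lambda>n. \<Prod>j=1..n. a j) \<longlonglongrightarrow> l"
    and b: "convergent (\<lambda>n. \<Sum>j=1..n. b j)"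
    and r: "0 \<le> r" "r < 1"
  obtains L where "uniform_limit (cball 0 r) (\<lambda>n. poly (rescaled_poly a b n)) L sequentially"
proof -
  define P where "P n = (\<Prod>j=1..n. a j)" for n
  have P0: "P n \<noteq> 0" for n
  proof -
    have "P n > 0" unfolding P_def using a by (intro prod_pos) auto
    then show ?thesis by simp
  qed
  obtain L where L: "uniform_limit (cball 0 r) (\<lambda>n. poly (monic_rescaled a b n)) L sequentially"
    and bnd: "bounded (L ` cball 0 r)"
    by (rule monic_rescaled_uniform_limit[of a r b, OF a r parameters_conditionally_summable[OF a a1 sq l b]])
  have "(\<lambda>n. 1 / P n) \<longlonglongrightarrow> 1 / l" using l P_def by (intro tendsto_divide) auto
  then have "uniform_limit (cball 0 r) (\<lambda>n _. complex_of_real (1 / P n)) (\<lambda>_. of_real (1 / l)) sequentially"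
    by (intro uniform_limitI) (auto simp: tendsto_iff dist_of_real elim!: eventually_mono simp flip: of_real_divide)
  then have "uniform_limit (cball 0 r) (\<lambda>n z. of_real (1 / P n) * poly (monic_rescaled a b n) z)
      (\<lambda>z. of_real (1 / l) * L z) sequentially"
    by (intro uniform_lim_mult L bnd) (auto simp: bounded_iff)
  moreover have "monic_rescaled a b n = smult (of_real (P n)) (rescaled_poly a b n)" for n
    unfolding monic_rescaled_def P_def ..
  then have "of_real (1 / P n) * poly (monic_rescaled a b n) z = poly (rescaled_poly a b n) z" for n z
    using P0[of n] by simp
  ultimately show thesis using that by simp
qed

lemma poly_rescaled_poly_0_nonzero_limit:
  assumes a: "\<And>n. n \<ge> 1 \<Longrightarrow> a n > 0" and l: "(\<lambda>n. \<Prod>j=1..n. a j) \<longlonglongrightarrow> l"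
    and L: "(\<lambda>n. poly (rescaled_poly a b n) 0) \<longlonglongrightarrow> L"
  shows "L \<noteq> 0"
proof -
  have "(\<lambda>n. complex_of_real (\<Prod>j=1..n. a j) * poly (rescaled_poly a b n) 0) \<longlonglongrightarrow> of_real l * L"
    by (intro tendsto_mult tendsto_of_real l L)
  then have "(\<lambda>n. 1 :: complex) \<longlonglongrightarrow> of_real l * L" using prod_times_rescaled_poly_0[of a _ b] a by simp
  then have "of_real l * L = 1" using LIMSEQ_unique tendsto_const by blast
  then show ?thesis by auto
qed

text \<open>Hurwitz's theorem needs a connected domain, whereas \<open>ball 0 1 - \<real>\<close> has two components.\<close>

lemma nonreal_disc_point_in_half_disc:
  fixes z :: complex
  assumes "z \<in> ball 0 1 - \<real>"
  obtains S where "open S" "connected S" "S \<subseteq> ball 0 1 - \<real>" "z \<in> S"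
proof -
  \<comment> \<open>The points whose imaginary part has the same sign as that of \<open>z\<close>.\<close>
  define S where "S = ball 0 1 \<inter> {w. 0 < inner w (of_real (Im z) * \<i>)}"
  have "open S" unfolding S_def by (intro open_Int open_ball open_Collect_less continuous_intros)
  moreover have "convex {w. 0 < inner w (of_real (Im z) * \<i>)}"
    using convex_halfspace_gt[of 0 "of_real (Im z) * \<i>"] by (simp add: inner_commute)
  then have "connected S" unfolding S_def by (intro convex_connected convex_Int convex_ball)
  moreover have "S \<subseteq> ball 0 1 - \<real>" by (auto simp: S_def inner_complex_def complex_is_Real_iff)
  moreover have "z \<in> S" using assms by (auto simp: S_def inner_complex_def complex_is_Real_iff zero_less_mult_iff linorder_neq_iff)
  ultimately show thesis using that by blast
qed

section \<open>The equivalence\<close>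

theorem theorem1p1:
  fixes a b :: "nat \<Rightarrow> real"
  assumes "\<And>n. n \<ge> 1 \<Longrightarrow> a n > 0"
    and "a \<longlonglongrightarrow> 1"
    and "b \<longlonglongrightarrow> 0"
  shows
    "(\<exists>L :: complex \<Rightarrow> complex.
        (\<forall>z\<in>ball 0 1. (\<lambda>n. poly (rescaled_poly a b n) z) \<longlonglongrightarrow> L z) \<and>
        (\<forall>z\<in>ball 0 1 - \<real>. L z \<noteq> 0) \<and>
        (\<forall>K. compact K \<and> K \<subseteq> ball 0 1 \<longrightarrow>
           uniform_limit K (\<lambda>n z. poly (rescaled_poly a b n) z) L sequentially))
     \<longleftrightarrow>
     (summable (\<lambda>n. \<bar>a (Suc n) - 1\<bar>\<^sup>2 + \<bar>b (Suc n)\<bar>\<^sup>2) \<and>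
      (\<exists>l. l \<noteq> 0 \<and> (\<lambda>n. \<Prod>j=1..n. a j) \<longlonglongrightarrow> l) \<and>
      convergent (\<lambda>n. \<Sum>j=1..n. b j))"
    (is "?Asymptotics \<longleftrightarrow> ?Parameters")
proof
  assume ?Asymptotics
  then obtain L where nz: "\<And>z. z \<in> ball 0 1 - \<real> \<Longrightarrow> L z \<noteq> 0"
    and lim: "\<And>K. compact K \<Longrightarrow> K \<subseteq> ball 0 1 \<Longrightarrow>
      uniform_limit K (\<lambda>n. poly (rescaled_poly a b n)) L sequentially" by blast
  obtain A where A: "\<And>n. \<bar>a n\<bar> \<le> A"
    using convergent_imp_Bseq[of a] assms(2) unfolding convergent_def Bseq_def by (metis real_norm_def)
  obtain B where B: "\<And>n. \<bar>b n\<bar> \<le> B"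
    using convergent_imp_Bseq[of b] assms(3) unfolding convergent_def Bseq_def by (metis real_norm_def)
  \<comment> \<open>The radius of a disc around \<open>0\<close> without zeros of any of the polynomials.\<close>
  define r where "r = 1 / (2 * (1 + B + 2 * A\<^sup>2))"
  have "1 \<le> 1 + B + 2 * A\<^sup>2" using order_trans[OF abs_ge_zero B[of 0]] by simp
  then have r: "0 < r" "r < 1" by (simp_all add: r_def)
  have L0: "L 0 \<noteq> 0"
  proof (rule nonvanishing_locally_uniform_limit[of "ball 0 1" "\<lambda>n. poly (rescaled_poly a b n)" L "\<i> / 2" "ball 0 r"])
    show "poly (rescaled_poly a b n) z \<noteq> 0" if "z \<in> ball 0 r" for n z
      using monic_rescaled_nonzero_near_0[of a A b B z n] assms(1) A B that
      by (auto simp: r_def monic_rescaled_def)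
    show "L (\<i> / 2) \<noteq> 0" by (rule nz) (auto simp: complex_is_Real_iff)
  qed (use r lim in \<open>auto intro!: holomorphic_intros\<close>)
  have "uniform_limit (ball 0 (1 / 2)) (\<lambda>n. poly (rescaled_poly a b n)) L sequentially"
    by (rule uniform_limit_on_subset[OF lim[of "cball 0 (1 / 2)"]]) auto
  from parameters_of_convergence_near_0[of a, OF assms(1) this _ _ L0]
  show ?Parameters by simp
next
  assume ?Parameters
  then obtain l where sq: "summable (\<lambda>n. \<bar>a (Suc n) - 1\<bar>\<^sup>2 + \<bar>b (Suc n)\<bar>\<^sup>2)"
    and l: "l \<noteq> 0" "(\<lambda>n. \<Prod>j=1..n. a j) \<longlonglongrightarrow> l" and b: "convergent (\<lambda>n. \<Sum>j=1..n. b j)"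
    by blast
  define L where "L z = lim (\<lambda>n. poly (rescaled_poly a b n) z)" for z
  have lim_cball: "uniform_limit (cball 0 r) (\<lambda>n. poly (rescaled_poly a b n)) L sequentially"
    if r: "0 \<le> r" "r < 1" for r
  proof -
    obtain g where g: "uniform_limit (cball 0 r) (\<lambda>n. poly (rescaled_poly a b n)) g sequentially"
      by (rule rescaled_poly_uniform_limit[of a b l r, OF assms(1,2) sq l b r])
    have "g z = L z" if "z \<in> cball 0 r" for z
      unfolding L_def using tendsto_uniform_limitI[OF g that] by (simp add: limI)
    then show ?thesis by (intro uniform_limit_cong'[THEN iffD1, OF _ _ g]) auto
  qed
  have lim: "uniform_limit K (\<lambda>n. poly (rescaled_poly a b n)) L sequentially"
    if K: "compact K" "K \<subseteq> ball 0 1" for K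
  proof (cases "K = {}")
    case False
    then obtain w where w: "w \<in> K" "\<And>z. z \<in> K \<Longrightarrow> norm z \<le> norm w"
      using continuous_attains_sup[OF K(1) False continuous_on_norm_id] by blast
    then show ?thesis
      using K by (intro uniform_limit_on_subset[OF lim_cball[of "norm w"]]) auto
  qed simp
  have pw: "(\<lambda>n. poly (rescaled_poly a b n) z) \<longlonglongrightarrow> L z" if "z \<in> ball 0 1" for z
    using tendsto_uniform_limitI[OF lim[of "{z}"], of z] that by simp
  have L0: "L 0 \<noteq> 0"
    by (rule poly_rescaled_poly_0_nonzero_limit[of a l b, OF assms(1) l(2) pw]) auto
  have "L z \<noteq> 0" if z: "z \<in> ball 0 1 - \<real>" for z
  proof -
    obtain S where S: "open S" "connected S" "S \<subseteq> ball 0 1 - \<real>" "z \<in> S"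
      using nonreal_disc_point_in_half_disc[OF z] by blast
    show ?thesis
    proof (rule nonvanishing_locally_uniform_limit[of "ball 0 1" "\<lambda>n. poly (rescaled_poly a b n)" L 0 S])
      show "poly (rescaled_poly a b n) w \<noteq> 0" if "w \<in> S" for n w
        using rescaled_poly_nonreal_nonzero[of a w b n] assms(1) S that by blast
    qed (use S L0 lim in \<open>auto intro!: holomorphic_intros\<close>)
  qed
  with pw lim show ?Asymptotics by blast
qed

end
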